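(* Let $(X,I,J,K)$ be a compact hypercomplex manifold and let $\pi:\mathcal{Z}=Tw(X)\to\mathbb{P}^1$ be the twistor projection of its twistor space. Then the complex manifold $\mathcal{Z}$ admits no Kähler metrics.
   Context: A hypercomplex manifold is a differentiable manifold $X$ endowed with three integrable complex structures $I,J,K$ satisfying $IJ=K$, $JK=I$, $KI=J$. For every $(a,b,c)\in S^2\subset\mathbb{R}^3$, the endomorphism $aI+bJ+cK$ is then an integrable complex structure on $X$. Identify $S^2$ with $\mathbb{P}^1=\mathbb{C}\cup\{\infty\}$ by $\zeta=(b+ic)/(1+a)$ (so $\zeta=0$ corresponds to $I$ and $\zeta=\infty$ to $-I$), and write $I_\zeta$ for the complex structure corresponding to $\zeta\in\mathbb{P}^1$. The twistor space $Tw(X)$ is the complex manifold with underlying real manifold $X\times\mathbb{P}^1$ and (integrable) complex structure $\mathcal{I}_{(x,\zeta)}(u,v)=(I_\zeta u,\ iv)$ for $(x,\zeta)\in X\times\mathbb{P}^1$, $u\in T_xX$, $v\in T_\zeta\mathbb{P}^1$ (real tangent spaces), where $iv$ is given by the standard complex structure of $\mathbb{P}^1$. The twistor projection $\pi:Tw(X)\to\mathbb{P}^1$, $(x,\zeta)\mapsto\zeta$, is holomorphic and $\pi^{-1}(\zeta)=(X,I_\zeta)$. *)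

theory Defs
  imports "HOL-Analysis.Analysis"
begin

section \<open>Smooth maps between open subsets of Euclidean spaces\<close>

primrec Ck_on :: "nat \<Rightarrow> 'e::real_normed_vector set \<Rightarrow> ('e \<Rightarrow> 'f::real_normed_vector) \<Rightarrow> bool" where
  "Ck_on 0 S f \<longleftrightarrow> continuous_on S f"
| "Ck_on (Suc k) S f \<longleftrightarrow> (\<forall>p\<in>S. f differentiable (at p)) \<and>
     (\<forall>v. Ck_on k S (\<lambda>p. frechet_derivative f (at p) v))"

text \<open>Only used for open sets.\<close>
definition smooth_on :: "'e::real_normed_vector set \<Rightarrow> ('e \<Rightarrow> 'f::real_normed_vector) \<Rightarrow> bool" where
  "smooth_on S f \<longleftrightarrow> (\<forall>k. Ck_on k S f)"


section \<open>Smooth manifolds\<close>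

text \<open>A manifold modelled on the Euclidean space \<open>'e\<close> is a topological space with an atlas
  indexed by the type \<open>'i\<close>. Charts with empty domain are allowed, so that indexing by a whole
  type is no restriction. Coordinate maps are only relevant on the chart domains.\<close>

record ('a, 'i, 'e) manifold =
  mtop :: "'a topology"
  cdom :: "'i \<Rightarrow> 'a set"
  coord :: "'i \<Rightarrow> 'a \<Rightarrow> 'e"

definition cimg :: "('a, 'i, 'e) manifold \<Rightarrow> 'i \<Rightarrow> 'e set" where
  "cimg M i = coord M i ` cdom M i"

definition cinv :: "('a, 'i, 'e) manifold \<Rightarrow> 'i \<Rightarrow> 'e \<Rightarrow> 'a" where
  "cinv M i = inv_into (cdom M i) (coord M i)"

definition transition :: "('a, 'i, 'e) manifold \<Rightarrow> 'i \<Rightarrow> 'i \<Rightarrow> 'e \<Rightarrow> 'e" where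
  "transition M i j = coord M j \<circ> cinv M i"

definition smooth_manifold :: "('a, 'i, 'e::euclidean_space) manifold \<Rightarrow> bool" where
  "smooth_manifold M \<longleftrightarrow>
     Hausdorff_space (mtop M) \<and> second_countable (mtop M) \<and>
     (\<Union>i. cdom M i) = topspace (mtop M) \<and>
     (\<forall>i. openin (mtop M) (cdom M i) \<and> open (cimg M i) \<and>
        homeomorphic_map (subtopology (mtop M) (cdom M i)) (top_of_set (cimg M i)) (coord M i)) \<and>
     (\<forall>i j. smooth_on (coord M i ` (cdom M i \<inter> cdom M j)) (transition M i j))"

definition product_manifold ::
  "('a, 'i, 'e) manifold \<Rightarrow> ('b, 'j, 'f) manifold \<Rightarrow> ('a \<times> 'b, 'i \<times> 'j, 'e \<times> 'f) manifold" where
  "product_manifold M N =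
     \<lparr>mtop = prod_topology (mtop M) (mtop N),
      cdom = (\<lambda>(i, j). cdom M i \<times> cdom N j),
      coord = (\<lambda>(i, j) (x, y). (coord M i x, coord N j y))\<rparr>"


section \<open>Tensor fields\<close>

text \<open>A tangent vector at \<open>x\<close> is given by a chart \<open>i\<close> around \<open>x\<close> and a coordinate vector
  \<open>v :: 'e\<close>; the same tangent vector has the coordinate vector \<open>tangent_change M i j x v\<close> in the
  chart \<open>j\<close>. Tensor fields are functions of chart, point and coordinate vectors that respect
  this change of coordinates.\<close>

definition tangent_change ::
  "('a, 'i, 'e::real_normed_vector) manifold \<Rightarrow> 'i \<Rightarrow> 'i \<Rightarrow> 'a \<Rightarrow> 'e \<Rightarrow> 'e" where
  "tangent_change M i j x = frechet_derivative (transition M i j) (at (coord M i x))"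

type_synonym ('a, 'i, 'e) endo_field = "'i \<Rightarrow> 'a \<Rightarrow> 'e \<Rightarrow> 'e"
type_synonym ('a, 'i, 'e) bilinear_field = "'i \<Rightarrow> 'a \<Rightarrow> 'e \<Rightarrow> 'e \<Rightarrow> real"

definition smooth_endo_field ::
  "('a, 'i, 'e::euclidean_space) manifold \<Rightarrow> ('a, 'i, 'e) endo_field \<Rightarrow> bool" where
  "smooth_endo_field M F \<longleftrightarrow>
     (\<forall>i. \<forall>x\<in>cdom M i. linear (F i x)) \<and>
     (\<forall>i v. smooth_on (cimg M i) (\<lambda>p. F i (cinv M i p) v)) \<and>
     (\<forall>i j. \<forall>x\<in>cdom M i \<inter> cdom M j. \<forall>v.
        tangent_change M i j x (F i x v) = F j x (tangent_change M i j x v))"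

definition smooth_bilinear_field ::
  "('a, 'i, 'e::euclidean_space) manifold \<Rightarrow> ('a, 'i, 'e) bilinear_field \<Rightarrow> bool" where
  "smooth_bilinear_field M g \<longleftrightarrow>
     (\<forall>i. \<forall>x\<in>cdom M i. bilinear (g i x)) \<and>
     (\<forall>i v w. smooth_on (cimg M i) (\<lambda>p. g i (cinv M i p) v w)) \<and>
     (\<forall>i j. \<forall>x\<in>cdom M i \<inter> cdom M j. \<forall>v w.
        g j x (tangent_change M i j x v) (tangent_change M i j x w) = g i x v w)"


section \<open>Complex structures\<close>

definition lie_bracket :: "('e::real_normed_vector \<Rightarrow> 'e) \<Rightarrow> ('e \<Rightarrow> 'e) \<Rightarrow> 'e \<Rightarrow> 'e" where
  "lie_bracket V W p = frechet_derivative W (at p) (V p) - frechet_derivative V (at p) (W p)"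

text \<open>The Nijenhuis tensor \<open>[V,W] + F([FV,W] + [V,FW]) - [FV,FW]\<close>.\<close>
definition nijenhuis ::
  "('e::real_normed_vector \<Rightarrow> 'e \<Rightarrow> 'e) \<Rightarrow> ('e \<Rightarrow> 'e) \<Rightarrow> ('e \<Rightarrow> 'e) \<Rightarrow> 'e \<Rightarrow> 'e" where
  "nijenhuis F V W p =
     lie_bracket V W p
     + F p (lie_bracket (\<lambda>q. F q (V q)) W p + lie_bracket V (\<lambda>q. F q (W q)) p)
     - lie_bracket (\<lambda>q. F q (V q)) (\<lambda>q. F q (W q)) p"

definition integrable_endo ::
  "('a, 'i, 'e::euclidean_space) manifold \<Rightarrow> ('a, 'i, 'e) endo_field \<Rightarrow> bool" where
  "integrable_endo M F \<longleftrightarrow>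
     (\<forall>i V W. smooth_on (cimg M i) V \<longrightarrow> smooth_on (cimg M i) W \<longrightarrow>
        (\<forall>p\<in>cimg M i. nijenhuis (\<lambda>q. F i (cinv M i q)) V W p = 0))"

text \<open>By the Newlander--Nirenberg theorem, vanishing of the Nijenhuis tensor is equivalent to the
  existence of an atlas of holomorphic coordinates.\<close>
definition complex_structure ::
  "('a, 'i, 'e::euclidean_space) manifold \<Rightarrow> ('a, 'i, 'e) endo_field \<Rightarrow> bool" where
  "complex_structure M F \<longleftrightarrow>
     smooth_endo_field M F \<and>
     (\<forall>i. \<forall>x\<in>cdom M i. \<forall>v. F i x (F i x v) = - v) \<and>
     integrable_endo M F"

definition hypercomplex_manifold ::
  "('a, 'i, 'e::euclidean_space) manifold \<Rightarrow> ('a, 'i, 'e) endo_field \<Rightarrow> ('a, 'i, 'e) endo_field \<Rightarrow>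
   ('a, 'i, 'e) endo_field \<Rightarrow> bool" where
  "hypercomplex_manifold X I J K \<longleftrightarrow>
     smooth_manifold X \<and>
     complex_structure X I \<and> complex_structure X J \<and> complex_structure X K \<and>
     (\<forall>i. \<forall>x\<in>cdom X i. \<forall>v.
        I i x (J i x v) = K i x v \<and> J i x (K i x v) = I i x v \<and> K i x (I i x v) = J i x v)"


section \<open>Kaehler metrics\<close>

definition riemannian_metric ::
  "('a, 'i, 'e::euclidean_space) manifold \<Rightarrow> ('a, 'i, 'e) bilinear_field \<Rightarrow> bool" where
  "riemannian_metric M g \<longleftrightarrow>
     smooth_bilinear_field M g \<and>
     (\<forall>i. \<forall>x\<in>cdom M i. (\<forall>v w. g i x v w = g i x w v) \<and> (\<forall>v. v \<noteq> 0 \<longrightarrow> g i x v v > 0))"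

definition hermitian_metric ::
  "('a, 'i, 'e::euclidean_space) manifold \<Rightarrow> ('a, 'i, 'e) endo_field \<Rightarrow>
   ('a, 'i, 'e) bilinear_field \<Rightarrow> bool" where
  "hermitian_metric M F g \<longleftrightarrow>
     riemannian_metric M g \<and>
     (\<forall>i. \<forall>x\<in>cdom M i. \<forall>v w. g i x (F i x v) (F i x w) = g i x v w)"

definition fundamental_form ::
  "('a, 'i, 'e) endo_field \<Rightarrow> ('a, 'i, 'e) bilinear_field \<Rightarrow> ('a, 'i, 'e) bilinear_field" where
  "fundamental_form F g i x v w = g i x (F i x v) w"

text \<open>The exterior derivative of a 2-form, evaluated at constant coordinate vector fields
  (whose brackets vanish): \<open>d\<omega>(u,v,w) = u \<omega>(v,w) + v \<omega>(w,u) + w \<omega>(u,v)\<close>.\<close>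
definition closed_2form ::
  "('a, 'i, 'e::euclidean_space) manifold \<Rightarrow> ('a, 'i, 'e) bilinear_field \<Rightarrow> bool" where
  "closed_2form M \<omega> \<longleftrightarrow>
     (\<forall>i. \<forall>p\<in>cimg M i. \<forall>u v w.
        frechet_derivative (\<lambda>q. \<omega> i (cinv M i q) v w) (at p) u
        + frechet_derivative (\<lambda>q. \<omega> i (cinv M i q) w u) (at p) v
        + frechet_derivative (\<lambda>q. \<omega> i (cinv M i q) u v) (at p) w = 0)"

definition kaehler_metric ::
  "('a, 'i, 'e::euclidean_space) manifold \<Rightarrow> ('a, 'i, 'e) endo_field \<Rightarrow>
   ('a, 'i, 'e) bilinear_field \<Rightarrow> bool" where
  "kaehler_metric M F g \<longleftrightarrow>
     hermitian_metric M F g \<and> closed_2form M (fundamental_form F g)"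


section \<open>The Riemann sphere\<close>

text \<open>\<open>None\<close> is the point at infinity. The two holomorphic charts are \<open>\<zeta>\<close> and \<open>1/\<zeta>\<close>.\<close>

datatype sphere_chart = Affine | At_Infinity

definition riemann_sphere :: "(complex option, sphere_chart, complex) manifold" where
  "riemann_sphere =
     \<lparr>mtop = Alexandroff_compactification euclidean,
      cdom = case_sphere_chart (- {None}) (- {Some 0}),
      coord = case_sphere_chart (case_option 0 (\<lambda>z. z)) (case_option 0 (\<lambda>z. inverse z))\<rparr>"

definition unit_sphere :: "(real \<times> real \<times> real) set" where
  "unit_sphere = {(a, b, c). a\<^sup>2 + b\<^sup>2 + c\<^sup>2 = 1}"

definition sphere_to_P1 :: "real \<times> real \<times> real \<Rightarrow> complex option" where
  "sphere_to_P1 = (\<lambda>(a, b, c). if a = -1 then None else Some (Complex b c / of_real (1 + a)))"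

definition P1_to_sphere :: "complex option \<Rightarrow> real \<times> real \<times> real" where
  "P1_to_sphere \<zeta> =
     (case \<zeta> of None \<Rightarrow> (-1, 0, 0)
      | Some z \<Rightarrow> ((1 - (cmod z)\<^sup>2) / (1 + (cmod z)\<^sup>2),
                  2 * Re z / (1 + (cmod z)\<^sup>2), 2 * Im z / (1 + (cmod z)\<^sup>2)))"

lemma P1_to_sphere_in_unit_sphere: "P1_to_sphere \<zeta> \<in> unit_sphere"
proof (cases \<zeta>)
  case (Some z)
  have pos: "1 + (cmod z)\<^sup>2 > 0"
    by (simp add: add_pos_nonneg)
  have "(1 - (cmod z)\<^sup>2)\<^sup>2 + (2 * Re z)\<^sup>2 + (2 * Im z)\<^sup>2 = (1 + (cmod z)\<^sup>2)\<^sup>2"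
    unfolding cmod_power2 by (simp add: power2_eq_square algebra_simps)
  then show ?thesis
    using pos by (simp add: Some P1_to_sphere_def unit_sphere_def power_divide flip: add_divide_distrib)
qed (simp add: P1_to_sphere_def unit_sphere_def)

lemma sphere_to_P1_P1_to_sphere: "sphere_to_P1 (P1_to_sphere \<zeta>) = \<zeta>"
proof (cases \<zeta>)
  case (Some z)
  define r where "r = (cmod z)\<^sup>2"
  have pos: "1 + r > 0"
    by (simp add: r_def add_pos_nonneg)
  have 1: "1 + (1 - r) / (1 + r) = 2 / (1 + r)"
    using pos by (simp add: field_simps)
  moreover from this have "(1 - r) / (1 + r) \<noteq> -1"
    using pos by (auto simp: field_simps)
  ultimately show ?thesis
    using pos by (auto simp: Some P1_to_sphere_def sphere_to_P1_def complex_eq_iff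
        simp flip: r_def)
qed (simp add: P1_to_sphere_def sphere_to_P1_def)

lemma P1_to_sphere_sphere_to_P1:
  assumes "s \<in> unit_sphere"
  shows "P1_to_sphere (sphere_to_P1 s) = s"
proof -
  obtain a b c where s: "s = (a, b, c)" by (cases s)
  have abc: "a\<^sup>2 + b\<^sup>2 + c\<^sup>2 = 1"
    using assms by (simp add: s unit_sphere_def)
  show ?thesis
  proof (cases "a = -1")
    case True
    then show ?thesis using abc
      by (simp add: s sphere_to_P1_def P1_to_sphere_def sum_power2_eq_zero_iff)
  next
    case False
    then have nz: "1 + a \<noteq> 0" by linarith
    define z where "z = Complex b c / of_real (1 + a)"
    have re: "Re z = b / (1 + a)" and im: "Im z = c / (1 + a)"
      by (simp_all add: z_def)
    have bc: "b\<^sup>2 + c\<^sup>2 = (1 - a) * (1 + a)"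
      using abc by (simp add: power2_eq_square algebra_simps)
    have "(cmod z)\<^sup>2 = (b\<^sup>2 + c\<^sup>2) / (1 + a)\<^sup>2"
      unfolding cmod_power2 re im by (simp add: power_divide add_divide_distrib)
    also have "\<dots> = (1 - a) / (1 + a)"
      unfolding bc using nz by (simp add: power2_eq_square)
    finally have r: "(cmod z)\<^sup>2 = (1 - a) / (1 + a)" .
    have p: "1 + (cmod z)\<^sup>2 = 2 / (1 + a)" and m: "1 - (cmod z)\<^sup>2 = 2 * a / (1 + a)"
      unfolding r using nz by (simp_all add: field_simps)
    have "P1_to_sphere (Some z) = (a, b, c)"
      unfolding P1_to_sphere_def option.case p m re im using nz by simp
    then show ?thesis
      using False by (simp add: s sphere_to_P1_def z_def)
  qed
qed


section \<open>The twistor space\<close>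

definition induced_structure ::
  "('a, 'i, 'e::real_vector) endo_field \<Rightarrow> ('a, 'i, 'e) endo_field \<Rightarrow> ('a, 'i, 'e) endo_field \<Rightarrow>
   complex option \<Rightarrow> ('a, 'i, 'e) endo_field" where
  "induced_structure I J K \<zeta> i x u =
     (case P1_to_sphere \<zeta> of (a, b, c) \<Rightarrow> a *\<^sub>R I i x u + b *\<^sub>R J i x u + c *\<^sub>R K i x u)"

definition twistor_space ::
  "('a, 'i, 'e) manifold \<Rightarrow> ('a \<times> complex option, 'i \<times> sphere_chart, 'e \<times> complex) manifold" where
  "twistor_space X = product_manifold X riemann_sphere"

text \<open>Since the charts of the Riemann sphere are holomorphic, its standard complex structure is
  multiplication by \<open>\<i>\<close> in both of them.\<close>
definition twistor_structure ::
  "('a, 'i, 'e::real_vector) endo_field \<Rightarrow> ('a, 'i, 'e) endo_field \<Rightarrow> ('a, 'i, 'e) endo_field \<Rightarrow>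
   ('a \<times> complex option, 'i \<times> sphere_chart, 'e \<times> complex) endo_field" where
  "twistor_structure I J K =
     (\<lambda>(i, j) (x, \<zeta>) (u, v). (induced_structure I J K \<zeta> i x u, \<i> * v))"

end

theory Submission
  imports Defs
begin

text \<open>
  Suppose \<open>\<omega>\<close> is the fundamental form of a Kaehler metric on the twistor space. The fibres over
  \<open>\<zeta> = 1\<close> and \<open>\<zeta> = -1\<close> carry the opposite complex structures \<open>J\<close> and \<open>-J\<close>, so the
  difference \<open>\<Omega>\<close> of the restrictions of \<open>\<omega>\<close> to them is \<open>h(J\<cdot>,\<cdot>)\<close> for a sum \<open>h\<close> of two
  Riemannian metrics, hence non-degenerate. As \<open>\<omega>\<close> is closed, integrating it along the segment from
  \<open>-1\<close> to \<open>1\<close> in the affine chart of \<open>P\<^sup>1\<close> gives a 1-form \<open>\<alpha>\<close> on \<open>X\<close> with \<open>d\<alpha> = \<Omega>\<close>. Thus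
  \<open>X\<close> carries an exact symplectic form. The vector field \<open>V\<close> with \<open>\<iota>\<^sub>V \<Omega> = \<alpha>\<close> then
  satisfies \<open>L\<^sub>V \<Omega> = \<Omega>\<close>, so it has constant positive divergence with respect to the
  Liouville volume, which contradicts the divergence theorem on the compact manifold \<open>X\<close>.
\<close>

section \<open>Continuously differentiable functions\<close>

text \<open>The points \<open>1\<close> and \<open>-1\<close> are antipodal on the sphere, and the
  real segment joining them stays in the affine chart, so the chart at infinity never enters. The
  antipodal pair \<open>0\<close> and infinity, with structures \<open>I\<close> and
  \<open>-I\<close>, would involve both charts. The textbook contradiction writes the top power of
  \<Omega> as d(\<alpha> \<Omega>^(n-1)) and applies Stokes' theorem, which takes wedge powers and
  an orientation. Here the density \<open>sqrt \<bar>det \<Omega>\<bar>\<close> replaces them: it is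
  positive in every chart and transforms with the absolute value of the Jacobian determinant,
  exactly as the change of variables formula asks. Stokes' theorem then shrinks to the fact that a
  partial derivative of a compactly supported function has integral 0. What remains global is
  handled by a partition of unity, to which V is applied, so that every integral is taken in a
  single chart.\<close>

abbreviation fderiv :: "('e::real_normed_vector \<Rightarrow> 'f::real_normed_vector) \<Rightarrow> 'e \<Rightarrow> 'e \<Rightarrow> 'f" where
  "fderiv f p \<equiv> frechet_derivative f (at p)"

text \<open>One continuous derivative suffices, because the divergence theorem, Jacobi's formula and
  the homotopy formula for \<open>al\<close> are all first order. This class is cheap to close under
  parameter integrals and contains the squared positive part, from which the bump functions are
  built. As in \<open>Ck_on\<close>, continuity is asked for each fixed direction
  separately.\<close>

definition C1_on :: "'e::real_normed_vector set \<Rightarrow> ('e \<Rightarrow> 'f::real_normed_vector) \<Rightarrow> bool" where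
  "C1_on S f \<longleftrightarrow> (\<forall>p\<in>S. f differentiable (at p)) \<and> (\<forall>v. continuous_on S (\<lambda>p. fderiv f p v))"

lemma smooth_on_imp_C1_on: "smooth_on S f \<Longrightarrow> C1_on S f"
  unfolding smooth_on_def C1_on_def by (auto dest: spec[of _ "Suc 0"])

lemma fderiv_eq: "(f has_derivative f') (at p) \<Longrightarrow> fderiv f p = f'"
  by (metis frechet_derivative_at)

lemma C1_onI:
  assumes "\<And>p. p \<in> S \<Longrightarrow> (f has_derivative f' p) (at p)"
    and "\<And>v. continuous_on S (\<lambda>p. f' p v)"
  shows "C1_on S f"
  unfolding C1_on_def
proof (intro conjI ballI allI)
  fix v
  have "continuous_on S (\<lambda>p. fderiv f p v) \<longleftrightarrow> continuous_on S (\<lambda>p. f' p v)"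
    using fderiv_eq[OF assms(1)] by (intro continuous_on_cong) auto
  then show "continuous_on S (\<lambda>p. fderiv f p v)"
    using assms(2) by blast
qed (use assms(1) in \<open>auto simp: differentiable_def\<close>)

lemma C1_on_has_derivative: "C1_on S f \<Longrightarrow> p \<in> S \<Longrightarrow> (f has_derivative fderiv f p) (at p)"
  unfolding C1_on_def by (simp flip: frechet_derivative_works)

lemma C1_on_fderiv_continuous: "C1_on S f \<Longrightarrow> continuous_on S (\<lambda>p. fderiv f p v)"
  unfolding C1_on_def by simp

lemma C1_on_linear_fderiv: "C1_on S f \<Longrightarrow> p \<in> S \<Longrightarrow> linear (fderiv f p)"
  using C1_on_has_derivative has_derivative_linear by blast

lemma C1_on_continuous: "C1_on S f \<Longrightarrow> continuous_on S f"
  by (meson C1_on_has_derivative continuous_at_imp_continuous_on has_derivative_continuous)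

lemma fderiv_cong_open:
  assumes "open S" "p \<in> S" "\<And>q. q \<in> S \<Longrightarrow> f q = g q"
  shows "fderiv f p = fderiv g p"
proof -
  have "(f has_derivative h) (at p) \<longleftrightarrow> (g has_derivative h) (at p)" for h
    using assms has_derivative_transform_within_open[of _ h p UNIV S] by metis
  then show ?thesis
    unfolding frechet_derivative_def by simp
qed

lemma C1_on_cong:
  assumes "open S" "\<And>q. q \<in> S \<Longrightarrow> f q = g q"
  shows "C1_on S f \<longleftrightarrow> C1_on S g"
proof -
  have *: "C1_on S g" if "C1_on S f" "\<And>q. q \<in> S \<Longrightarrow> f q = g q" for f g
  proof (rule C1_onI)
    show "(g has_derivative fderiv f p) (at p)" if "p \<in> S" for p
      using has_derivative_transform_within_open[OF C1_on_has_derivative[OF \<open>C1_on S f\<close> that] \<open>open S\<close> that]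
        \<open>\<And>q. q \<in> S \<Longrightarrow> f q = g q\<close> by blast
  qed (use that C1_on_fderiv_continuous in blast)
  show ?thesis
    using *[of f g] *[of g f] assms(2) by auto
qed

lemma C1_on_Un:
  assumes "open S" "open T" "C1_on S f" "C1_on T f"
  shows "C1_on (S \<union> T) f"
  using assms unfolding C1_on_def by (auto intro: continuous_on_open_Un)

lemma C1_on_const: "C1_on S (\<lambda>_. c)"
  by (rule C1_onI[where f'="\<lambda>_ _. 0"]) auto

lemma C1_on_bounded_linear: "bounded_linear f \<Longrightarrow> C1_on S f"
  by (rule C1_onI[where f'="\<lambda>_. f"]) (auto intro: bounded_linear_imp_has_derivative)

lemma C1_on_add: "C1_on S f \<Longrightarrow> C1_on S g \<Longrightarrow> C1_on S (\<lambda>p. f p + g p)"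
  by (rule C1_onI[where f'="\<lambda>p v. fderiv f p v + fderiv g p v"])
    (auto intro!: continuous_intros derivative_eq_intros C1_on_has_derivative C1_on_fderiv_continuous)

lemma C1_on_diff: "C1_on S f \<Longrightarrow> C1_on S g \<Longrightarrow> C1_on S (\<lambda>p. f p - g p)"
  by (rule C1_onI[where f'="\<lambda>p v. fderiv f p v - fderiv g p v"])
    (auto intro!: continuous_intros derivative_eq_intros C1_on_has_derivative C1_on_fderiv_continuous)

lemma C1_on_sum: "(\<And>i. i \<in> A \<Longrightarrow> C1_on S (f i)) \<Longrightarrow> C1_on S (\<lambda>p. \<Sum>i\<in>A. f i p)"
  by (induction A rule: infinite_finite_induct) (auto intro: C1_on_const C1_on_add)

lemma C1_on_scaleR:
  fixes f :: "'e::real_normed_vector \<Rightarrow> real"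
  shows "C1_on S f \<Longrightarrow> C1_on S g \<Longrightarrow> C1_on S (\<lambda>p. f p *\<^sub>R g p)"
  by (rule C1_onI[where f'="\<lambda>p v. f p *\<^sub>R fderiv g p v + fderiv f p v *\<^sub>R g p"])
    (auto intro!: derivative_eq_intros continuous_on_add continuous_on_scaleR
      C1_on_has_derivative C1_on_fderiv_continuous dest: C1_on_continuous)

lemma C1_on_mult:
  fixes f g :: "'e::real_normed_vector \<Rightarrow> real"
  shows "C1_on S f \<Longrightarrow> C1_on S g \<Longrightarrow> C1_on S (\<lambda>p. f p * g p)"
  using C1_on_scaleR[of S f g] by simp

lemma C1_on_prod:
  fixes f :: "'i \<Rightarrow> 'e::real_normed_vector \<Rightarrow> real"
  shows "(\<And>i. i \<in> A \<Longrightarrow> C1_on S (f i)) \<Longrightarrow> C1_on S (\<lambda>p. \<Prod>i\<in>A. f i p)"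
  by (induction A rule: infinite_finite_induct) (auto intro: C1_on_const C1_on_mult)

text \<open>In finite dimension, continuity for each fixed direction already gives joint continuity:
  expanding \<open>V p\<close> in the basis leaves finitely many fixed directions with continuous
  coefficients.\<close>

lemma C1_on_fderiv_continuous_field:
  fixes f :: "'e::euclidean_space \<Rightarrow> 'f::real_normed_vector" and h :: "'d::topological_space \<Rightarrow> 'e"
  assumes f: "C1_on T f" and h: "continuous_on S h" "h ` S \<subseteq> T" and V: "continuous_on S V"
  shows "continuous_on S (\<lambda>p. fderiv f (h p) (V p))"
proof -
  have "continuous_on S (\<lambda>p. \<Sum>b\<in>Basis. (V p \<bullet> b) *\<^sub>R fderiv f (h p) b)"
    by (intro continuous_intros V continuous_on_compose2[OF C1_on_fderiv_continuous[OF f] h])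
  moreover have "fderiv f (h p) (V p) = (\<Sum>b\<in>Basis. (V p \<bullet> b) *\<^sub>R fderiv f (h p) b)"
    if "p \<in> S" for p
  proof -
    have lin: "linear (fderiv f (h p))"
      using C1_on_linear_fderiv[OF f] that h by blast
    have "fderiv f (h p) (V p) = fderiv f (h p) (\<Sum>b\<in>Basis. (V p \<bullet> b) *\<^sub>R b)"
      by (simp add: euclidean_representation)
    then show ?thesis
      by (simp add: linear_sum[OF lin] linear_scale[OF lin])
  qed
  ultimately show ?thesis
    by (simp cong: continuous_on_cong)
qed

lemma C1_on_compose:
  fixes f :: "'e::real_normed_vector \<Rightarrow> 'f::euclidean_space" and g :: "'f \<Rightarrow> 'g::real_normed_vector"
  assumes f: "C1_on S f" and g: "C1_on T g" and fS: "f ` S \<subseteq> T"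
  shows "C1_on S (\<lambda>p. g (f p))"
proof (rule C1_onI)
  show "((\<lambda>p. g (f p)) has_derivative (\<lambda>v. fderiv g (f p) (fderiv f p v))) (at p)" if "p \<in> S" for p
    using has_derivative_compose[OF C1_on_has_derivative[OF f that]] C1_on_has_derivative[OF g, of "f p"]
      that fS by blast
qed (intro C1_on_fderiv_continuous_field[OF g] C1_on_continuous[OF f] C1_on_fderiv_continuous[OF f] fS)

lemma C1_on_compose_real:
  fixes f :: "'e::real_normed_vector \<Rightarrow> real" and g :: "real \<Rightarrow> real"
  assumes f: "C1_on S f" and g: "\<And>p. p \<in> S \<Longrightarrow> (g has_real_derivative g' (f p)) (at (f p))"
    and "continuous_on (f ` S) g'"
  shows "C1_on S (\<lambda>p. g (f p))"
proof (rule C1_onI)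
  show "((\<lambda>p. g (f p)) has_derivative (\<lambda>v. fderiv f p v * g' (f p))) (at p)" if "p \<in> S" for p
    by (rule DERIV_compose_FDERIV[OF g[OF that] C1_on_has_derivative[OF f that]])
  show "continuous_on S (\<lambda>p. fderiv f p v * g' (f p))" for v
    by (intro continuous_intros C1_on_fderiv_continuous[OF f]
        continuous_on_compose2[OF assms(3) C1_on_continuous[OF f]]) auto
qed

lemma C1_on_inverse:
  fixes f :: "'e::real_normed_vector \<Rightarrow> real"
  assumes "C1_on S f" "\<And>p. p \<in> S \<Longrightarrow> f p \<noteq> 0"
  shows "C1_on S (\<lambda>p. inverse (f p))"
  by (rule C1_on_compose_real[OF assms(1), where g'="\<lambda>x. - (inverse x ^ 2)"])
    (use assms(2) in \<open>auto intro!: derivative_eq_intros continuous_intros simp: power2_eq_square\<close>)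

lemma C1_on_divide:
  fixes f g :: "'e::real_normed_vector \<Rightarrow> real"
  assumes "C1_on S f" "C1_on S g" "\<And>p. p \<in> S \<Longrightarrow> g p \<noteq> 0"
  shows "C1_on S (\<lambda>p. f p / g p)"
  unfolding divide_inverse by (intro C1_on_mult C1_on_inverse assms)

text \<open>Squaring removes the kink of the positive part: at 0 the difference quotient is 0 on the
  left and \<open>h\<close> on the right. This is the profile of the bump functions below.\<close>

lemma C1_on_max_0_squared:
  fixes f :: "'e::real_normed_vector \<Rightarrow> real"
  assumes "C1_on S f"
  shows "C1_on S (\<lambda>p. (max 0 (f p))\<^sup>2)"
proof (rule C1_on_compose_real[OF assms, where g'="\<lambda>x. 2 * max 0 x"])
  have "((\<lambda>x. (max 0 x)\<^sup>2) has_real_derivative 2 * max 0 x) (at x)" for x :: real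
  proof -
    consider "x > 0" | "x < 0" | "x = 0" by linarith
    then show ?thesis
    proof cases
      case 1
      have "((\<lambda>x. x\<^sup>2) has_real_derivative 2 * x) (at x)"
        by (auto intro!: derivative_eq_intros)
      then have "((\<lambda>x. (max 0 x)\<^sup>2) has_real_derivative 2 * x) (at x)"
        by (rule has_field_derivative_transform_within_open[where S="{0<..}"]) (use 1 in auto)
      then show ?thesis using 1 by simp
    next
      case 2
      have "((\<lambda>x. 0) has_real_derivative 0) (at x)"
        by simp
      then have "((\<lambda>x. (max 0 x)\<^sup>2) has_real_derivative 0) (at x)"
        by (rule has_field_derivative_transform_within_open[where S="{..<0}"]) (use 2 in auto)
      then show ?thesis using 2 by simp
    next
      case 3
      have "((\<lambda>h. (max 0 h)\<^sup>2 / h) \<longlongrightarrow> 0) (at (0::real))"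
      proof (rule Lim_null_comparison)
        show "\<forall>\<^sub>F h in at 0. norm ((max 0 h)\<^sup>2 / h) \<le> \<bar>h\<bar>" for h :: real
          by (rule always_eventually) (auto simp: max_def power2_eq_square)
        show "((\<lambda>h. \<bar>h\<bar>) \<longlongrightarrow> 0) (at (0::real))"
          by (auto intro!: tendsto_eq_intros)
      qed
      then show ?thesis
        using 3 by (simp add: DERIV_def)
    qed
  qed
  then show "((\<lambda>x. (max 0 x)\<^sup>2) has_real_derivative 2 * max 0 (f p)) (at (f p))" for p
    by blast
qed (auto intro!: continuous_intros)

text \<open>The form \<open>sqrt \<bar>x\<bar> / (2 * x)\<close> of the derivative is valid for both
  signs of \<open>x\<close>. It will be applied to the determinant of an antisymmetric matrix. This
  is the square of a Pfaffian, but the absolute value spares a proof of its positivity.\<close>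

lemma C1_on_sqrt_abs:
  fixes f :: "'e::real_normed_vector \<Rightarrow> real"
  assumes "C1_on S f" "\<And>p. p \<in> S \<Longrightarrow> f p \<noteq> 0"
  shows "C1_on S (\<lambda>p. sqrt \<bar>f p\<bar>)"
    and "p \<in> S \<Longrightarrow> fderiv (\<lambda>p. sqrt \<bar>f p\<bar>) p v = fderiv f p v * (sqrt \<bar>f p\<bar> / (2 * f p))"
proof -
  have der: "((\<lambda>x. sqrt \<bar>x\<bar>) has_real_derivative sqrt \<bar>x\<bar> / (2 * x)) (at x)" if "x \<noteq> 0" for x :: real
  proof (cases "x > 0")
    case True
    have "((\<lambda>x. sqrt x) has_real_derivative inverse (sqrt x) / 2) (at x)"
      using DERIV_real_sqrt[OF True] .
    then have "((\<lambda>x. sqrt \<bar>x\<bar>) has_real_derivative inverse (sqrt x) / 2) (at x)"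
      by (rule has_field_derivative_transform_within_open[where S="{0<..}"]) (use True in auto)
    moreover have "inverse (sqrt x) / 2 = sqrt \<bar>x\<bar> / (2 * x)"
      using True by (simp add: field_simps)
    ultimately show ?thesis by metis
  next
    case False
    then have neg: "x < 0" using that by simp
    have "((\<lambda>x. sqrt (- x)) has_real_derivative - (inverse (sqrt (- x)) / 2)) (at x)"
      using neg by (auto intro!: derivative_eq_intros)
    then have "((\<lambda>x. sqrt \<bar>x\<bar>) has_real_derivative - (inverse (sqrt (- x)) / 2)) (at x)"
      by (rule has_field_derivative_transform_within_open[where S="{..<0}"]) (use neg in auto)
    moreover have "- (inverse (sqrt (- x)) / 2) = sqrt \<bar>x\<bar> / (2 * x)"
      using neg by (simp add: field_simps)
    ultimately show ?thesis by metis
  qed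
  show "C1_on S (\<lambda>p. sqrt \<bar>f p\<bar>)"
    by (rule C1_on_compose_real[OF assms(1), where g="\<lambda>x. sqrt \<bar>x\<bar>" and g'="\<lambda>x. sqrt \<bar>x\<bar> / (2 * x)"])
      (use assms(2) der in \<open>auto intro!: continuous_intros\<close>)
  show "fderiv (\<lambda>p. sqrt \<bar>f p\<bar>) p v = fderiv f p v * (sqrt \<bar>f p\<bar> / (2 * f p))" if "p \<in> S"
    using fderiv_eq[OF DERIV_compose_FDERIV[OF der C1_on_has_derivative[OF assms(1) that]]] assms(2) that
    by simp
qed

lemma C1_on_Pair:
  assumes "C1_on S f" "C1_on S g"
  shows "C1_on S (\<lambda>p. (f p, g p))"
  by (rule C1_onI[where f'="\<lambda>p v. (fderiv f p v, fderiv g p v)"])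
    (auto intro!: has_derivative_Pair continuous_intros C1_on_has_derivative C1_on_fderiv_continuous assms)

lemma C1_on_inner:
  fixes f :: "'e::real_normed_vector \<Rightarrow> 'f::euclidean_space"
  shows "C1_on S f \<Longrightarrow> C1_on S (\<lambda>p. f p \<bullet> c)"
  by (rule C1_onI[where f'="\<lambda>p v. fderiv f p v \<bullet> c"])
    (auto intro!: continuous_intros derivative_eq_intros C1_on_has_derivative C1_on_fderiv_continuous)

section \<open>Coordinates indexed by a basis\<close>

text \<open>The change of variables formula of the library is only available on \<open>real ^ 'n\<close> with a finite
  well-ordered index type, whence this copy of \<open>Basis\<close> as a type.\<close>

typedef (overloaded) 'e basis_index = "Basis :: 'e::euclidean_space set"
  morphisms basis_vec Basis_index
  using nonempty_Basis by blast

lemma range_basis_vec: "range basis_vec = (Basis :: 'e::euclidean_space set)"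
  using type_definition.Rep_range[OF type_definition_basis_index] .

lemma inj_basis_vec: "inj basis_vec"
  by (meson basis_vec_inject injI)

lemma bij_basis_vec: "bij_betw basis_vec UNIV (Basis :: 'e::euclidean_space set)"
  using inj_basis_vec range_basis_vec by (simp add: bij_betw_def)

text \<open>The order is pulled back from an enumeration of the basis. Any well-order would do,
  since determinants and integrals do not depend on it.\<close>

instantiation basis_index :: (euclidean_space) "{finite, wellorder}"
begin

definition less_eq_basis_index :: "'a basis_index \<Rightarrow> 'a basis_index \<Rightarrow> bool" where
  "x \<le> y \<longleftrightarrow> to_nat_on Basis (basis_vec x) \<le> to_nat_on Basis (basis_vec y)"

definition less_basis_index :: "'a basis_index \<Rightarrow> 'a basis_index \<Rightarrow> bool" where
  "x < y \<longleftrightarrow> to_nat_on Basis (basis_vec x) < to_nat_on Basis (basis_vec y)"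

instance
proof
  show "finite (UNIV :: 'a basis_index set)"
    using bij_betw_finite[OF bij_basis_vec] by simp
  fix x y z :: "'a basis_index"
  show "(x < y) = (x \<le> y \<and> \<not> y \<le> x)" "x \<le> x" "x \<le> y \<or> y \<le> x"
    unfolding less_eq_basis_index_def less_basis_index_def by linarith+
  show "x \<le> y \<Longrightarrow> y \<le> z \<Longrightarrow> x \<le> z"
    unfolding less_eq_basis_index_def by linarith
  assume "x \<le> y" "y \<le> x"
  then have "to_nat_on Basis (basis_vec x) = to_nat_on Basis (basis_vec y)"
    unfolding less_eq_basis_index_def by linarith
  then have "basis_vec x = basis_vec y"
    using to_nat_on_inj[OF countable_finite[OF finite_Basis] basis_vec basis_vec] by blast
  then show "x = y"
    by (simp add: basis_vec_inject)
next
  fix P and x :: "'a basis_index"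
  assume step: "\<And>u :: 'a basis_index. (\<And>v. v < u \<Longrightarrow> P v) \<Longrightarrow> P u"
  show "P x"
    by (rule measure_induct_rule[where f="\<lambda>x. to_nat_on Basis (basis_vec x)"])
      (rule step, unfold less_basis_index_def, blast)
qed

end

lemma CARD_basis_index: "CARD('e::euclidean_space basis_index) = DIM('e)"
  using bij_basis_vec bij_betw_same_card by blast

lemma sum_Basis_index:
  "(\<Sum>b\<in>(Basis :: 'e::euclidean_space set). f b) = (\<Sum>i\<in>UNIV. f (basis_vec i))"
  using sum.reindex_bij_betw[OF bij_basis_vec, of f] by simp

lemma basis_vec_in_Basis [simp]: "basis_vec i \<in> Basis"
  using basis_vec .

lemma inner_basis_vec: "basis_vec i \<bullet> basis_vec j = (if i = j then 1 else 0)"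
  by (simp add: inner_Basis basis_vec_inject)

lemma euclidean_representation_index: "(\<Sum>i\<in>UNIV. (x \<bullet> basis_vec i) *\<^sub>R basis_vec i) = x"
  using euclidean_representation[of x] unfolding sum_Basis_index .

definition to_coords :: "'e::euclidean_space \<Rightarrow> real ^ 'e basis_index" where
  "to_coords x = (\<chi> i. x \<bullet> basis_vec i)"

definition of_coords :: "real ^ 'e basis_index \<Rightarrow> 'e::euclidean_space" where
  "of_coords y = (\<Sum>i\<in>UNIV. y $ i *\<^sub>R basis_vec i)"

lemma of_coords_to_coords [simp]: "of_coords (to_coords x) = x"
  unfolding of_coords_def to_coords_def by (simp add: euclidean_representation_index)

lemma of_coords_inner: "of_coords y \<bullet> basis_vec i = y $ i"
  unfolding of_coords_def by (simp add: inner_sum_left inner_basis_vec if_distrib cong: if_cong)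

lemma to_coords_of_coords [simp]: "to_coords (of_coords y) = y"
  unfolding to_coords_def by (simp add: of_coords_inner)

lemma linear_to_coords: "linear to_coords"
  by (rule linearI) (simp_all add: to_coords_def vec_eq_iff inner_add_left)

lemma linear_of_coords: "linear of_coords"
  by (rule linearI) (simp_all add: of_coords_def scaleR_add_left sum.distrib scaleR_sum_right)

lemma bounded_linear_to_coords: "bounded_linear to_coords"
  using linear_to_coords linear_conv_bounded_linear by blast

lemma bounded_linear_of_coords: "bounded_linear of_coords"
  using linear_of_coords linear_conv_bounded_linear by blast

lemma to_coords_image_cbox: "to_coords ` cbox u v = cbox (to_coords u) (to_coords v)"
proof -
  have "(\<forall>b\<in>Basis. P b) \<longleftrightarrow> (\<forall>i. P (basis_vec i))" for P :: "'a \<Rightarrow> bool"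
    using range_basis_vec by (metis basis_vec_in_Basis imageE)
  note this[of "\<lambda>b. u \<bullet> b \<le> x \<bullet> b \<and> x \<bullet> b \<le> v \<bullet> b" for x]
  then have *: "x \<in> cbox u v \<longleftrightarrow> to_coords x \<in> cbox (to_coords u) (to_coords v)" for x
    unfolding mem_box(2)[of x u v] mem_box_cart(2) to_coords_def vec_lambda_beta .
  show ?thesis
  proof (intro set_eqI iffI)
    fix y assume "y \<in> cbox (to_coords u) (to_coords v)"
    then have "of_coords y \<in> cbox u v"
      unfolding * by simp
    then show "y \<in> to_coords ` cbox u v"
      by (rule image_eqI[rotated]) simp
  qed (use * in blast)
qed

lemma of_coords_image_cbox: "of_coords ` cbox u v = cbox (of_coords u) (of_coords v)"
proof -
  have "of_coords ` cbox u v = of_coords ` to_coords ` cbox (of_coords u) (of_coords v)"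
    unfolding to_coords_image_cbox by simp
  then show ?thesis
    unfolding image_image by simp
qed

text \<open>A box and its coordinate box have the same side lengths, indexed once by
  \<open>Basis\<close> and once by \<open>'e basis_index\<close>.\<close>

lemma content_of_coords: "measure lborel (cbox (of_coords u) (of_coords v :: 'e::euclidean_space)) = measure lborel (cbox u v)"
proof (cases "cbox u v = {}")
  case True
  then show ?thesis
    using of_coords_image_cbox[of u v] by (simp flip: of_coords_image_cbox)
next
  case False
  then have False': "cbox (of_coords u) (of_coords v) \<noteq> {}"
    by (simp flip: of_coords_image_cbox)
  have "(\<Prod>b\<in>Basis. of_coords v \<bullet> b - of_coords u \<bullet> b) = (\<Prod>i\<in>UNIV. v $ i - u $ i)"
    using prod.reindex_bij_betw[OF bij_basis_vec, of "\<lambda>b. of_coords v \<bullet> b - of_coords u \<bullet> b"]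
    by (simp add: of_coords_inner)
  then show ?thesis
    using False False' by (simp add: content_cbox' content_cbox_if_cart)
qed

lemma content_to_coords: "measure lborel (cbox (to_coords u) (to_coords v)) = measure lborel (cbox u v)"
  using content_of_coords[of "to_coords u" "to_coords v"] by simp

text \<open>\<open>has_integral_twiddle\<close> transports integrals over boxes along bijections
  that map boxes to boxes and scale their content by a fixed factor, here 1. The bounded set
  \<open>K\<close> is put into a box and the integrand extended by 0, so \<open>K\<close> may have
  any shape.\<close>

lemma has_integral_isomorphism:
  fixes g :: "'a::euclidean_space \<Rightarrow> 'b::euclidean_space" and f :: "'b \<Rightarrow> real"
  assumes inv: "\<And>x. h (g x) = x" "\<And>y. g (h y) = y" and cont: "\<And>x. continuous (at x) g"
    and img: "\<And>u v. g ` cbox u v = cbox (g u) (g v)" "\<And>u v. h ` cbox u v = cbox (h u) (h v)"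
    and cnt: "\<And>u v. measure lborel (cbox (g u) (g v)) = measure lborel (cbox u v)"
    and f: "(f has_integral i) K" and "bounded K"
  shows "((\<lambda>x. f (g x)) has_integral i) (h ` K)"
proof -
  obtain a b where K: "K \<subseteq> cbox a b"
    using \<open>bounded K\<close> bounded_subset_cbox_symmetric by blast
  then have "((\<lambda>x. if x \<in> K then f x else 0) has_integral i) (cbox a b)"
    using f by (simp add: has_integral_restrict)
  then have "((\<lambda>x. if g x \<in> K then f (g x) else 0) has_integral (1/1) *\<^sub>R i) (h ` cbox a b)"
    by (intro has_integral_twiddle inv cont) (use img cnt in auto)
  moreover have "g x \<in> K \<longleftrightarrow> x \<in> h ` K" for x
    by (metis inv image_iff)
  ultimately have "((\<lambda>x. if x \<in> h ` K then f (g x) else 0) has_integral i) (h ` cbox a b)"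
    by simp
  then show ?thesis
    using K by (subst (asm) has_integral_restrict) auto
qed

lemma has_integral_of_coords:
  fixes f :: "'e::euclidean_space \<Rightarrow> real"
  assumes "(f has_integral i) K" "bounded K"
  shows "((\<lambda>y. f (of_coords y)) has_integral i) (to_coords ` K)"
  by (rule has_integral_isomorphism)
    (use assms in \<open>auto simp: to_coords_image_cbox of_coords_image_cbox content_of_coords
      intro: linear_continuous_at bounded_linear_of_coords\<close>)

lemma has_integral_to_coords:
  fixes f :: "real ^ 'e::euclidean_space basis_index \<Rightarrow> real"
  assumes "(f has_integral i) K" "bounded K"
  shows "((\<lambda>x. f (to_coords x)) has_integral i) (of_coords ` K)"
  by (rule has_integral_isomorphism)
    (use assms in \<open>auto simp: to_coords_image_cbox of_coords_image_cbox content_to_coords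
      intro: linear_continuous_at bounded_linear_to_coords\<close>)

definition coord_matrix :: "('e::euclidean_space \<Rightarrow> 'e) \<Rightarrow> real ^ 'e basis_index ^ 'e basis_index" where
  "coord_matrix T = (\<chi> i j. T (basis_vec j) \<bullet> basis_vec i)"

lemma absolutely_integrable_compact:
  fixes f :: "'a::euclidean_space \<Rightarrow> 'b::euclidean_space"
  assumes "compact K" "continuous_on K f"
  shows "f absolutely_integrable_on K"
proof -
  have "integrable lborel (\<lambda>x. indicator K x *\<^sub>R f x)"
    by (rule borel_integrable_compact[OF assms])
  then show ?thesis
    unfolding set_integrable_def by (subst integrable_completion) auto
qed

text \<open>Conjugation by \<open>to_coords\<close> turns \<open>g\<close> into a map of
  \<open>real ^ 'e basis_index\<close>, and the matrix of the conjugated derivative is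
  \<open>coord_matrix (g' x)\<close>.\<close>

lemma integral_change_of_variables:
  fixes g :: "'e::euclidean_space \<Rightarrow> 'e" and f :: "'e \<Rightarrow> real"
  assumes K: "compact K" and g: "\<And>x. x \<in> K \<Longrightarrow> (g has_derivative g' x) (at x)"
    and inj: "inj_on g K" and f: "continuous_on (g ` K) f"
  shows "integral (g ` K) f = integral K (\<lambda>x. \<bar>det (coord_matrix (g' x))\<bar> * f (g x))"
proof -
  define G where "G = to_coords \<circ> g \<circ> of_coords"
  define G' where "G' y = to_coords \<circ> g' (of_coords y) \<circ> of_coords" for y
  \<comment> \<open>The theorem applied below has vector-valued integrands, hence the passage
    through 1-vectors.\<close>
  define F :: "real ^ 'e basis_index \<Rightarrow> real ^ 1" where "F y = vec (f (of_coords y))" for y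
  have contg: "continuous_on K g"
    using g has_derivative_at_withinI has_derivative_continuous_on by blast
  have cK: "compact (to_coords ` K)" and cgK: "compact (g ` K)"
    by (auto intro!: compact_continuous_image K contg linear_continuous_on bounded_linear_to_coords)
  have GK: "G ` to_coords ` K = to_coords ` g ` K"
    unfolding G_def image_image by simp
  have derG: "(G has_derivative G' y) (at y within to_coords ` K)" if "y \<in> to_coords ` K" for y
    unfolding G_def G'_def
    using that
    by (intro has_derivative_at_withinI[OF diff_chain_at[OF
        bounded_linear_imp_has_derivative[OF bounded_linear_of_coords]]]
        diff_chain_at[OF g bounded_linear_imp_has_derivative[OF bounded_linear_to_coords],
          unfolded comp_assoc]) auto
  have injG: "inj_on G (to_coords ` K)"
  proof (rule inj_onI)
    fix x y assume "x \<in> to_coords ` K" "y \<in> to_coords ` K" "G x = G y"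
    then obtain x' y' where "x' \<in> K" "y' \<in> K" "x = to_coords x'" "y = to_coords y'" "to_coords (g x') = to_coords (g y')"
      by (auto simp: G_def)
    then show "x = y"
      by (metis inj inj_onD of_coords_to_coords)
  qed
  have mat: "matrix (G' (to_coords x)) = coord_matrix (g' x)" for x
  proof -
    have "of_coords (axis j 1) = basis_vec j" for j :: "'e basis_index"
      unfolding of_coords_def axis_def by (simp add: if_distribR if_distrib cong: if_cong)
    then show ?thesis
      unfolding matrix_def coord_matrix_def G'_def comp_def of_coords_to_coords
      by (simp add: to_coords_def)
  qed
  have "continuous_on (to_coords ` g ` K) (\<lambda>y. f (of_coords y))"
    by (rule continuous_on_compose2[OF f linear_continuous_on[OF bounded_linear_of_coords]]) auto
  then have contF: "continuous_on (G ` to_coords ` K) F"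
    unfolding GK F_def vec_def by (intro continuous_intros)
  have "compact (G ` to_coords ` K)"
    unfolding GK by (intro compact_continuous_image cgK linear_continuous_on bounded_linear_to_coords)
  then have "F absolutely_integrable_on (G ` to_coords ` K)"
    using absolutely_integrable_compact contF by blast
  with has_absolute_integral_change_of_variables_compact[OF cK derG injG, of F]
  have "(\<lambda>x. \<bar>det (matrix (G' x))\<bar> *\<^sub>R F (G x)) absolutely_integrable_on (to_coords ` K)"
    and int: "integral (to_coords ` K) (\<lambda>x. \<bar>det (matrix (G' x))\<bar> *\<^sub>R F (G x)) = integral (G ` to_coords ` K) F"
    by blast+
  then have "(\<lambda>x. (\<bar>det (matrix (G' x))\<bar> *\<^sub>R F (G x)) $ 1) integrable_on (to_coords ` K)"
    unfolding absolutely_integrable_on_1_iff absolutely_integrable_on_def by blast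
  then have ib: "(\<lambda>y. \<bar>det (matrix (G' y))\<bar> * f (g (of_coords y))) integrable_on (to_coords ` K)"
    by (simp add: F_def G_def)
  have eq: "integral (to_coords ` K) (\<lambda>y. \<bar>det (matrix (G' y))\<bar> * f (g (of_coords y)))
      = integral (to_coords ` g ` K) (\<lambda>y. f (of_coords y))"
    using int unfolding integral_on_1_eq GK by (simp add: F_def G_def vec_eq_iff)
  have "((\<lambda>x. \<bar>det (matrix (G' (to_coords x)))\<bar> * f (g (of_coords (to_coords x)))) has_integral
      integral (to_coords ` K) (\<lambda>y. \<bar>det (matrix (G' y))\<bar> * f (g (of_coords y)))) (of_coords ` to_coords ` K)"
    using has_integral_to_coords[OF integrable_integral[OF ib]] cK compact_imp_bounded by blast
  then have "integral K (\<lambda>x. \<bar>det (coord_matrix (g' x))\<bar> * f (g x)) =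
      integral (to_coords ` g ` K) (\<lambda>y. f (of_coords y))"
    by (simp add: mat image_image eq integral_unique)
  moreover have "f integrable_on g ` K"
    using absolutely_integrable_compact[OF cgK f] absolutely_integrable_on_def by blast
  then have "integral (to_coords ` g ` K) (\<lambda>y. f (of_coords y)) = integral (g ` K) f"
    using has_integral_of_coords[OF integrable_integral] cgK compact_imp_bounded
    by (metis integral_unique)
  ultimately show ?thesis by simp
qed

section \<open>The divergence theorem for compactly supported functions\<close>

lemma has_integral_translation_cbox:
  fixes f :: "'e::euclidean_space \<Rightarrow> real"
  assumes "(f has_integral i) (cbox a b)"
  shows "((\<lambda>x. f (x + c)) has_integral i) (cbox (a - c) (b - c))"
  using has_integral_affinity'[OF assms, of 1 c] by simp

text \<open>The integral of a translate \<open>x \<mapsto> F (x + t v)\<close> does not depend on \<open>t\<close>; differentiate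
  under the integral sign at \<open>t = 0\<close>.\<close>
lemma integral_fderiv_compact_support:
  fixes F :: "'e::euclidean_space \<Rightarrow> real"
  assumes F: "C1_on UNIV F" and K: "compact K" "\<And>x. x \<notin> K \<Longrightarrow> F x = 0"
  shows "((\<lambda>x. fderiv F x v) has_integral 0) UNIV"
proof -
  define r where "r t x = x + t *\<^sub>R v" for t :: real and x :: 'e
  \<comment> \<open>One box contains all translates of \<open>K\<close> by
    \<open>t *\<^sub>R v\<close> with \<open>\<bar>t\<bar> \<le> 1\<close>, so the domain of
    integration does not move with \<open>t\<close> when differentiating under the integral.\<close>
  have "compact ((\<lambda>(x, t). r t x) ` (K \<times> {-1..1}))"
    unfolding r_def case_prod_unfold
    by (intro compact_continuous_image compact_Times K continuous_intros) auto
  then obtain a where a: "(\<lambda>(x, t). r t x) ` (K \<times> {-1..1}) \<subseteq> cbox (- a) a"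
    using bounded_subset_cbox_symmetric compact_imp_bounded by blast
  have in_box: "x + t *\<^sub>R v \<in> cbox (- a) a" if "x \<in> K" "\<bar>t\<bar> \<le> 1" for x t
    using a that unfolding r_def by (force simp: abs_le_iff)
  have KB: "K \<subseteq> cbox (- a) a"
    using in_box[of _ 0] by auto
  have contF: "continuous_on X F" for X
    using C1_on_continuous[OF F] continuous_on_subset by blast
  define I where "I = integral UNIV F"
  have FI: "(F has_integral I) UNIV"
    unfolding I_def
    by (rule integrable_integral, rule integrable_on_superset[of _ "cbox (- a) a"])
      (use K KB in \<open>auto intro!: integrable_continuous contF\<close>)
  have int_const: "integral (cbox (- a) a) (\<lambda>x. F (x + t *\<^sub>R v)) = I" if "\<bar>t\<bar> \<le> 1" for t
  proof -
    define A where "A = cbox (- a) a"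
    have sub: "K \<subseteq> (\<lambda>x. x + t *\<^sub>R v) ` A"
    proof
      fix x assume "x \<in> K"
      then have "x + (- t) *\<^sub>R v \<in> A"
        unfolding A_def using that by (intro in_box) auto
      then show "x \<in> (\<lambda>x. x + t *\<^sub>R v) ` A"
        by (rule image_eqI[rotated]) simp
    qed
    have img: "(\<lambda>x. x + t *\<^sub>R v) ` A = cbox (- a + t *\<^sub>R v) (a + t *\<^sub>R v)"
      unfolding A_def using cbox_translation[of "t *\<^sub>R v" "- a" a]
      by (simp add: add.commute)
    have "(F has_integral I) (cbox (- a + t *\<^sub>R v) (a + t *\<^sub>R v))"
      by (subst has_integral_restrict_UNIV[symmetric], rule has_integral_eq[OF _ FI])
        (use sub K(2) img in auto)
    from has_integral_translation_cbox[OF this, of "t *\<^sub>R v"] show ?thesis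
      by (simp add: integral_unique)
  qed
  define fx where "fx t x = fderiv F (x + t *\<^sub>R v) v" for t x
  have fx: "((\<lambda>t. F (x + t *\<^sub>R v)) has_vector_derivative fx t x) (at t within {-1..1})" for t x
  proof -
    have "((\<lambda>t. F (x + t *\<^sub>R v)) has_derivative (\<lambda>s. fderiv F (x + t *\<^sub>R v) (s *\<^sub>R v))) (at t within {-1..1})"
      by (rule has_derivative_at_withinI,
          rule has_derivative_compose[where f="\<lambda>t. x + t *\<^sub>R v", OF _ C1_on_has_derivative[OF F]])
        (auto intro!: derivative_eq_intros)
    then show ?thesis
      unfolding has_vector_derivative_def fx_def
      using linear_scale[OF C1_on_linear_fderiv[OF F UNIV_I]] by simp
  qed
  have contfx: "continuous_on X (\<lambda>(t, x). fx t x)" for X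
    unfolding fx_def case_prod_unfold
    by (rule continuous_on_compose2[OF C1_on_fderiv_continuous[OF F]]) (auto intro!: continuous_intros)
  have "((\<lambda>t. integral (cbox (- a) a) (\<lambda>x. F (x + t *\<^sub>R v))) has_vector_derivative
      integral (cbox (- a) a) (fx 0)) (at 0 within {-1..1})"
    by (rule leibniz_rule_vector_derivative[OF fx])
      (auto intro!: integrable_continuous contfx continuous_on_compose2[OF contF[of UNIV]] continuous_intros)
  moreover have "((\<lambda>t. integral (cbox (- a) a) (\<lambda>x. F (x + t *\<^sub>R v))) has_vector_derivative 0)
      (at 0 within {-1..1})"
    by (rule has_vector_derivative_transform[where f="\<lambda>_. I"]) (auto simp: int_const abs_le_iff)
  ultimately have "integral (cbox (- a) a) (fx 0) = 0"
    using vector_derivative_unique_at at_within_Icc_at[of "-1" 0 "1::real"] by auto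
  moreover have "fx 0 integrable_on cbox (- a) a"
    unfolding fx_def by (auto intro!: integrable_continuous continuous_on_subset[OF C1_on_fderiv_continuous[OF F]])
  ultimately have "(fx 0 has_integral 0) (cbox (- a) a)"
    by (metis integrable_integral)
  moreover have "fx 0 x = 0" if "x \<notin> cbox (- a) a" for x
  proof -
    have "open (- K)"
      using K(1) compact_imp_closed by blast
    then have "fderiv F x = fderiv (\<lambda>_. 0) x"
      by (rule fderiv_cong_open) (use that KB K(2) in auto)
    then show ?thesis
      by (simp add: fx_def)
  qed
  ultimately have "(fx 0 has_integral 0) UNIV"
    by (rule has_integral_on_superset) simp_all
  moreover have "fx 0 = (\<lambda>x. fderiv F x v)"
    by (simp add: fx_def fun_eq_iff)
  ultimately show ?thesis
    by simp
qed

section \<open>Jacobi's formula and the Liouville vector field\<close>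

text \<open>In the Leibniz expansion a permutation other than the identity moves at least two
  indices, so its product has at least two off-diagonal factors. Differentiating one factor leaves
  another, which vanishes at the identity matrix. Only the diagonal product contributes, and it
  gives the trace.\<close>

lemma has_derivative_det_at_id:
  fixes c :: "'n::finite \<Rightarrow> 'n \<Rightarrow> 'e::real_normed_vector \<Rightarrow> real"
  assumes der: "\<And>i j. (c i j has_derivative c' i j) (at p)"
    and id: "\<And>i j. c i j p = (if i = j then 1 else 0)"
  shows "((\<lambda>q. det (\<chi> i j. c i j q)) has_derivative (\<lambda>v. \<Sum>i\<in>UNIV. c' i i v)) (at p)"
proof -
  let ?P = "{\<pi>. \<pi> permutes (UNIV :: 'n set)}"
  have perm_term: "(\<Sum>i\<in>UNIV. c' i (\<pi> i) v * (\<Prod>j\<in>UNIV - {i}. c j (\<pi> j) p)) =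
      (if \<pi> = id then \<Sum>i\<in>UNIV. c' i i v else 0)" if \<pi>: "\<pi> permutes UNIV" for \<pi> :: "'n \<Rightarrow> 'n" and v
  proof (cases "\<pi> = id")
    case False
    then obtain k where k: "\<pi> k \<noteq> k"
      by (auto simp: fun_eq_iff)
    have inj: "inj \<pi>"
      using \<pi> permutes_inj by blast
    have "(\<Prod>j\<in>UNIV - {i}. c j (\<pi> j) p) = 0" for i
    proof -
      \<comment> \<open>Take \<open>k\<close> itself unless \<open>i = k\<close>, and then
        \<open>\<pi> k\<close>, which is moved as well by injectivity.\<close>
      have "\<exists>j. j \<noteq> i \<and> j \<noteq> \<pi> j"
        using k inj by (metis injD)
      then show ?thesis
        by (intro prod_zero) (auto simp: id)
    qed
    then show ?thesis
      by (simp only: False if_False mult_zero_right sum.neutral_const)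
  qed (simp add: id)
  have "((\<lambda>q. \<Sum>\<pi>\<in>?P. of_int (sign \<pi>) * (\<Prod>i\<in>UNIV. c i (\<pi> i) q)) has_derivative
      (\<lambda>v. \<Sum>\<pi>\<in>?P. of_int (sign \<pi>) * (\<Sum>i\<in>UNIV. c' i (\<pi> i) v * (\<Prod>j\<in>UNIV - {i}. c j (\<pi> j) p)))) (at p)"
    by (intro has_derivative_sum has_derivative_mult_right has_derivative_prod der)
  moreover have "(\<Sum>\<pi>\<in>?P. of_int (sign \<pi>) * (\<Sum>i\<in>UNIV. c' i (\<pi> i) v * (\<Prod>j\<in>UNIV - {i}. c j (\<pi> j) p)))
      = (\<Sum>i\<in>UNIV. c' i i v)" for v
  proof -
    have "(\<Sum>\<pi>\<in>?P. of_int (sign \<pi>) * (\<Sum>i\<in>UNIV. c' i (\<pi> i) v * (\<Prod>j\<in>UNIV - {i}. c j (\<pi> j) p)))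
        = (\<Sum>\<pi>\<in>?P. if \<pi> = id then \<Sum>i\<in>UNIV. c' i i v else 0)"
      by (rule sum.cong) (auto simp: perm_term sign_id)
    also have "\<dots> = (\<Sum>i\<in>UNIV. c' i i v)"
      by (simp add: sum.delta permutes_id)
    finally show ?thesis .
  qed
  ultimately show ?thesis
    unfolding det_def by simp
qed

text \<open>Multiplication by the constant matrix \<open>B\<close>, the inverse of \<open>A\<close>
  at \<open>p\<close>, makes the family equal to the identity at \<open>p\<close> and reduces to the
  previous lemma. The factor det A(p) undoes the multiplication, since det A(p) det B = 1.\<close>

lemma jacobi_formula:
  fixes A :: "'n::finite \<Rightarrow> 'n \<Rightarrow> 'e::real_normed_vector \<Rightarrow> real"
  assumes der: "\<And>i j. (A i j has_derivative A' i j) (at p)"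
    and B: "B ** (\<chi> i j. A i j p) = mat 1"
  shows "((\<lambda>q. det (\<chi> i j. A i j q)) has_derivative
    (\<lambda>v. det (\<chi> i j. A i j p) * (\<Sum>i\<in>UNIV. \<Sum>j\<in>UNIV. B $ i $ j * A' j i v))) (at p)"
proof -
  define c where "c i j q = (\<Sum>k\<in>UNIV. B $ i $ k * A k j q)" for i j q
  have BA: "B ** (\<chi> i j. A i j q) = (\<chi> i j. c i j q)" for q
    by (simp add: matrix_matrix_mult_def c_def vec_eq_iff)
  have "((\<lambda>q. det (\<chi> i j. c i j q)) has_derivative (\<lambda>v. \<Sum>i\<in>UNIV. \<Sum>k\<in>UNIV. B $ i $ k * A' k i v)) (at p)"
  proof (rule has_derivative_det_at_id[where c'="\<lambda>i j v. \<Sum>k\<in>UNIV. B $ i $ k * A' k j v"])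
    show "(c i j has_derivative (\<lambda>v. \<Sum>k\<in>UNIV. B $ i $ k * A' k j v)) (at p)" for i j
      unfolding c_def by (intro has_derivative_sum has_derivative_mult_right der)
    show "c i j p = (if i = j then 1 else 0)" for i j
      using B unfolding BA by (simp add: vec_eq_iff mat_def)
  qed
  then have "((\<lambda>q. det (\<chi> i j. A i j p) * det (\<chi> i j. c i j q)) has_derivative
    (\<lambda>v. det (\<chi> i j. A i j p) * (\<Sum>i\<in>UNIV. \<Sum>j\<in>UNIV. B $ i $ j * A' j i v))) (at p)"
    by (intro has_derivative_mult_right)
  moreover have "det (\<chi> i j. A i j p) * det (\<chi> i j. c i j q) = det (\<chi> i j. A i j q)" for q
    using arg_cong[OF B, of det] by (simp flip: BA add: det_mul mult.assoc[symmetric] mult.commute)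
  ultimately show ?thesis by simp
qed

lemma C1_on_det:
  fixes A :: "'n::finite \<Rightarrow> 'n \<Rightarrow> 'e::real_normed_vector \<Rightarrow> real"
  assumes "\<And>i j. C1_on S (A i j)"
  shows "C1_on S (\<lambda>q. det (\<chi> i j. A i j q))"
  unfolding det_def vec_lambda_beta by (intro C1_on_sum C1_on_mult C1_on_const C1_on_prod assms)

text \<open>The field \<open>V\<close> with \<open>\<iota>\<^sub>V W = a\<close> satisfies \<open>L\<^sub>V W = W\<close> since \<open>d W = 0\<close> and \<open>d a = W\<close>, so the Liouville
  density \<open>sqrt \<bar>det W\<bar>\<close> is expanded by \<open>V\<close> at the constant rate \<open>DIM/2\<close>.\<close>
lemma liouville_field:
  fixes W :: "'e::euclidean_space basis_index \<Rightarrow> 'e basis_index \<Rightarrow> 'e \<Rightarrow> real"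
  assumes S: "open S" and CW: "\<And>i j. C1_on S (W i j)" and Ca: "\<And>j. C1_on S (a j)"
    and exact: "\<And>i j p. p \<in> S \<Longrightarrow> W i j p = fderiv (a j) p (basis_vec i) - fderiv (a i) p (basis_vec j)"
    and closed: "\<And>i j k p. p \<in> S \<Longrightarrow> fderiv (W i j) p (basis_vec k) + fderiv (W j k) p (basis_vec i)
      + fderiv (W k i) p (basis_vec j) = 0"
    and nondeg: "\<And>p. p \<in> S \<Longrightarrow> det (\<chi> i j. W i j p) \<noteq> 0"
  obtains V where "\<And>k. C1_on S (V k)"
    and "\<And>j p. p \<in> S \<Longrightarrow> (\<Sum>k\<in>UNIV. V k p * W k j p) = a j p"
    and "\<And>p. p \<in> S \<Longrightarrow> (\<Sum>k\<in>UNIV. fderiv (\<lambda>q. V k q * sqrt \<bar>det (\<chi> i j. W i j q)\<bar>) p (basis_vec k))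
      = real DIM('e) / 2 * sqrt \<bar>det (\<chi> i j. W i j p)\<bar>"
proof
  define dW where "dW q = det (\<chi> i j. W i j q)" for q
  \<comment> \<open>Cramer's rule gives the solution as a quotient of determinants, hence visibly
    C1.\<close>
  define V where "V k q = det (\<chi> i j. if j = k then a i q else W j i q) / dW q" for k q
  have CdW: "C1_on S dW"
    unfolding dW_def by (intro C1_on_det CW)
  show CV: "C1_on S (V k)" for k
  proof -
    have "C1_on S (\<lambda>q. if j = k then a i q else W j i q)" for i j
      using Ca CW by (cases "j = k") simp_all
    then show ?thesis
      unfolding V_def by (intro C1_on_divide C1_on_det CdW) (use nondeg in \<open>auto simp: dW_def\<close>)
  qed
  show solve: "(\<Sum>k\<in>UNIV. V k p * W k j p) = a j p" if "p \<in> S" for j p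
  proof -
    \<comment> \<open>\<open>V\<close> is contracted with the first index of \<open>W\<close>, which
      is the row index, so the linear system has the transposed matrix.\<close>
    define A where "A = transpose (\<chi> i j. W i j p)"
    have "det A = dW p"
      unfolding A_def dW_def by (rule det_transpose)
    then have "A *v (\<chi> k. V k p) = (\<chi> j. a j p)"
      unfolding V_def
      by (subst cramer) (use nondeg[OF that] in \<open>auto simp: A_def dW_def transpose_def vec_eq_iff cong: if_cong\<close>)
    from arg_cong[OF this, of "\<lambda>x. x $ j"] show ?thesis
      by (simp add: matrix_vector_mult_def A_def transpose_def mult.commute)
  qed
  fix p assume p: "p \<in> S"
  let ?W = "\<chi> i j. W i j p" and ?e = basis_vec
  obtain B where B: "B ** ?W = mat 1" "?W ** B = mat 1"
    using nondeg[OF p] invertible_det_nz[of ?W] unfolding invertible_def by metis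
  have BW: "(\<Sum>j\<in>UNIV. B $ i $ j * W j k p) = (if i = k then 1 else 0)"
    and WB: "(\<Sum>j\<in>UNIV. W i j p * B $ j $ k) = (if i = k then 1 else 0)" for i k
    using arg_cong[OF B(1), of "\<lambda>M. M $ i $ k"] arg_cong[OF B(2), of "\<lambda>M. M $ i $ k"]
    by (simp_all add: matrix_matrix_mult_def mat_def)
  define V' W' where "V' k i = fderiv (V k) p (?e i)" and "W' i j k = fderiv (W i j) p (?e k)" for i j k
  have antisym: "W i j q = - W j i q" if "q \<in> S" for i j q
    using exact[OF that] by simp
  have antisym': "W' i j k = - W' j i k" for i j k
  proof -
    have "fderiv (W i j) p = fderiv (\<lambda>q. - W j i q) p"
      by (rule fderiv_cong_open[OF S p]) (rule antisym)
    also have "\<dots> = (\<lambda>v. - fderiv (W j i) p v)"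
      by (rule fderiv_eq, rule has_derivative_minus, rule C1_on_has_derivative[OF CW p])
    finally show ?thesis
      by (simp add: W'_def)
  qed
  have da: "fderiv (a j) p (?e i) = (\<Sum>k\<in>UNIV. V' k i * W k j p + V k p * W' k j i)" for i j
  proof -
    have "fderiv (a j) p = fderiv (\<lambda>q. \<Sum>k\<in>UNIV. V k q * W k j q) p"
      by (rule fderiv_cong_open[OF S p]) (simp add: solve)
    also have "\<dots> = (\<lambda>v. \<Sum>k\<in>UNIV. V k p * fderiv (W k j) p v + fderiv (V k) p v * W k j p)"
      by (rule fderiv_eq, intro has_derivative_sum has_derivative_mult C1_on_has_derivative[OF _ p] CV CW)
    finally show ?thesis
      by (simp add: V'_def W'_def add.commute)
  qed
  \<comment> \<open>The equation L_V W = W in coordinates. Inserting the derivative of the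
    contraction equation into \<open>exact\<close> leaves the terms V_k (d_i W_kj - d_j W_ki), which
    \<open>closed\<close> turns into V_k d_k W_ij.\<close>
  have lie: "W i j p = (\<Sum>k\<in>UNIV. V' k i * W k j p) + (\<Sum>k\<in>UNIV. V' k j * W i k p)
      + (\<Sum>k\<in>UNIV. V k p * W' i j k)" for i j
  proof -
    have "W i j p = (\<Sum>k\<in>UNIV. (V' k i * W k j p + V k p * W' k j i) - (V' k j * W k i p + V k p * W' k i j))"
      by (simp only: exact[OF p, of i j] da sum_subtractf)
    also have "\<dots> = (\<Sum>k\<in>UNIV. V' k i * W k j p + V' k j * W i k p + V k p * W' i j k)"
    proof (rule sum.cong[OF refl])
      fix k
      have *: "W' k j i = W' i j k + W' k i j"
        using closed[OF p, of i j k] antisym'[of j k i] unfolding W'_def by linarith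
      then show "V' k i * W k j p + V k p * W' k j i - (V' k j * W k i p + V k p * W' k i j)
          = V' k i * W k j p + V' k j * W i k p + V k p * W' i j k"
        unfolding * antisym[OF p, of k i] by (simp add: algebra_simps)
    qed
    finally show ?thesis
      by (simp add: sum.distrib)
  qed
  define divV where "divV = (\<Sum>k\<in>UNIV. V' k k)"
  define tr where "tr k = (\<Sum>j\<in>UNIV. \<Sum>i\<in>UNIV. B $ j $ i * W' i j k)" for k
  \<comment> \<open>The previous identity is traced against the inverse matrix \<open>B\<close>. The
    left side gives the dimension, each of the first two terms on the right the divergence of
    \<open>V\<close>, and the third the logarithmic derivative of det W along
    \<open>V\<close>.\<close>
  have "real DIM('e) = (\<Sum>i\<in>UNIV. \<Sum>j\<in>UNIV. W i j p * B $ j $ i)"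
    by (simp add: WB CARD_basis_index)
  also have "\<dots> = (\<Sum>i\<in>UNIV. \<Sum>j\<in>UNIV. ((\<Sum>k\<in>UNIV. V' k i * W k j p) + (\<Sum>k\<in>UNIV. V' k j * W i k p)
      + (\<Sum>k\<in>UNIV. V k p * W' i j k)) * B $ j $ i)"
    by (intro sum.cong refl arg_cong2[where f="(*)"] lie)
  also have "\<dots> = (\<Sum>i\<in>UNIV. \<Sum>j\<in>UNIV. \<Sum>k\<in>UNIV. V' k i * W k j p * B $ j $ i)
      + (\<Sum>i\<in>UNIV. \<Sum>j\<in>UNIV. \<Sum>k\<in>UNIV. V' k j * W i k p * B $ j $ i)
      + (\<Sum>i\<in>UNIV. \<Sum>j\<in>UNIV. \<Sum>k\<in>UNIV. V k p * W' i j k * B $ j $ i)"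
    by (simp add: sum.distrib distrib_right sum_distrib_right)
  also have "(\<Sum>i\<in>UNIV. \<Sum>j\<in>UNIV. \<Sum>k\<in>UNIV. V' k i * W k j p * B $ j $ i) = divV"
  proof -
    have "(\<Sum>i\<in>UNIV. \<Sum>j\<in>UNIV. \<Sum>k\<in>UNIV. V' k i * W k j p * B $ j $ i)
        = (\<Sum>i\<in>UNIV. \<Sum>k\<in>UNIV. V' k i * (\<Sum>j\<in>UNIV. W k j p * B $ j $ i))"
      by (subst sum.swap) (simp add: sum_distrib_left mult.assoc)
    then show ?thesis
      by (simp add: WB divV_def if_distrib cong: if_cong)
  qed
  also have "(\<Sum>i\<in>UNIV. \<Sum>j\<in>UNIV. \<Sum>k\<in>UNIV. V' k j * W i k p * B $ j $ i) = divV"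
  proof -
    have "(\<Sum>i\<in>UNIV. \<Sum>j\<in>UNIV. \<Sum>k\<in>UNIV. V' k j * W i k p * B $ j $ i)
        = (\<Sum>j\<in>UNIV. \<Sum>i\<in>UNIV. \<Sum>k\<in>UNIV. V' k j * W i k p * B $ j $ i)"
      by (rule sum.swap)
    also have "\<dots> = (\<Sum>j\<in>UNIV. \<Sum>k\<in>UNIV. \<Sum>i\<in>UNIV. V' k j * W i k p * B $ j $ i)"
      by (rule sum.cong[OF refl], rule sum.swap)
    also have "\<dots> = (\<Sum>j\<in>UNIV. \<Sum>k\<in>UNIV. V' k j * (\<Sum>i\<in>UNIV. B $ j $ i * W i k p))"
      by (simp add: sum_distrib_left ac_simps)
    finally show ?thesis
      by (simp add: BW divV_def if_distrib cong: if_cong)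
  qed
  also have "(\<Sum>i\<in>UNIV. \<Sum>j\<in>UNIV. \<Sum>k\<in>UNIV. V k p * W' i j k * B $ j $ i)
      = (\<Sum>k\<in>UNIV. V k p * (\<Sum>j\<in>UNIV. \<Sum>i\<in>UNIV. B $ j $ i * W' i j k))"
  proof -
    have "(\<Sum>i\<in>UNIV. \<Sum>j\<in>UNIV. \<Sum>k\<in>UNIV. V k p * W' i j k * B $ j $ i)
        = (\<Sum>j\<in>UNIV. \<Sum>i\<in>UNIV. \<Sum>k\<in>UNIV. V k p * W' i j k * B $ j $ i)"
      by (rule sum.swap)
    also have "\<dots> = (\<Sum>j\<in>UNIV. \<Sum>k\<in>UNIV. \<Sum>i\<in>UNIV. V k p * W' i j k * B $ j $ i)"
      by (rule sum.cong[OF refl], rule sum.swap)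
    also have "\<dots> = (\<Sum>k\<in>UNIV. \<Sum>j\<in>UNIV. \<Sum>i\<in>UNIV. V k p * W' i j k * B $ j $ i)"
      by (rule sum.swap)
    finally show ?thesis
      by (simp add: sum_distrib_left ac_simps)
  qed
  finally have trace: "real DIM('e) = 2 * divV
      + (\<Sum>k\<in>UNIV. V k p * tr k)"
    by (simp add: tr_def)
  define \<rho> where "\<rho> = sqrt \<bar>dW p\<bar>"
  \<comment> \<open>By Jacobi's formula \<open>tr k\<close> is the logarithmic derivative of
    \<open>dW\<close>, and the square root halves it. This half, matched with the factor 2 in
    \<open>trace\<close>, produces the rate \<open>DIM('e) / 2\<close>.\<close>
  have d\<rho>: "fderiv (\<lambda>q. sqrt \<bar>dW q\<bar>) p (?e k) = tr k * (\<rho> / 2)" for k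
  proof -
    have "fderiv dW p = (\<lambda>v. dW p * (\<Sum>i\<in>UNIV. \<Sum>j\<in>UNIV. B $ i $ j * fderiv (W j i) p v))"
      unfolding dW_def by (rule fderiv_eq, rule jacobi_formula[OF C1_on_has_derivative[OF CW p] B(1)])
    moreover have "fderiv (\<lambda>q. sqrt \<bar>dW q\<bar>) p (?e k) = fderiv dW p (?e k) * (sqrt \<bar>dW p\<bar> / (2 * dW p))"
      by (rule C1_on_sqrt_abs(2)[OF CdW _ p]) (use nondeg in \<open>simp add: dW_def\<close>)
    ultimately show ?thesis
      using nondeg[OF p] by (simp add: \<rho>_def tr_def W'_def flip: dW_def)
  qed
  have C\<rho>: "C1_on S (\<lambda>q. sqrt \<bar>dW q\<bar>)"
    by (rule C1_on_sqrt_abs(1)[OF CdW]) (use nondeg in \<open>simp add: dW_def\<close>)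
  have "fderiv (\<lambda>q. V k q * sqrt \<bar>dW q\<bar>) p (?e k) = V k p * fderiv (\<lambda>q. sqrt \<bar>dW q\<bar>) p (?e k) + V' k k * \<rho>" for k
  proof -
    have "fderiv (\<lambda>q. V k q * sqrt \<bar>dW q\<bar>) p
        = (\<lambda>v. V k p * fderiv (\<lambda>q. sqrt \<bar>dW q\<bar>) p v + fderiv (V k) p v * sqrt \<bar>dW p\<bar>)"
      by (rule fderiv_eq, intro has_derivative_mult C1_on_has_derivative[OF _ p] CV C\<rho>)
    then show ?thesis
      by (simp add: V'_def \<rho>_def)
  qed
  then have "(\<Sum>k\<in>UNIV. fderiv (\<lambda>q. V k q * sqrt \<bar>dW q\<bar>) p (?e k))
      = (\<Sum>k\<in>UNIV. V k p * tr k) * (\<rho> / 2) + divV * \<rho>"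
    by (simp add: d\<rho> sum.distrib divV_def sum_distrib_right mult.assoc)
  also have "\<dots> = real DIM('e) / 2 * \<rho>"
    unfolding trace by (simp add: algebra_simps)
  finally show "(\<Sum>k\<in>UNIV. fderiv (\<lambda>q. V k q * sqrt \<bar>det (\<chi> i j. W i j q)\<bar>) p (?e k))
      = real DIM('e) / 2 * sqrt \<bar>det (\<chi> i j. W i j p)\<bar>"
    by (simp add: \<rho>_def dW_def)
qed

section \<open>Charts of a smooth manifold\<close>

locale manifold_charts =
  fixes M :: "('a, 'i, 'e::euclidean_space) manifold"
  assumes smooth: "smooth_manifold M"
begin

lemma Hausdorff: "Hausdorff_space (mtop M)"
  and cover: "(\<Union>i. cdom M i) = topspace (mtop M)"
  and openin_cdom: "openin (mtop M) (cdom M i)"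
  and open_cimg: "open (cimg M i)"
  and homeo_coord:
    "homeomorphic_map (subtopology (mtop M) (cdom M i)) (top_of_set (cimg M i)) (coord M i)"
  and smooth_transition: "smooth_on (coord M i ` (cdom M i \<inter> cdom M j)) (transition M i j)"
  using smooth unfolding smooth_manifold_def by blast+

lemma cdom_subset: "cdom M i \<subseteq> topspace (mtop M)"
  unfolding cover[symmetric] by (rule UN_upper) simp

lemma topspace_cdom: "topspace (subtopology (mtop M) (cdom M i)) = cdom M i"
  by (rule topspace_subtopology_subset[OF cdom_subset])

lemma inj_coord: "inj_on (coord M i) (cdom M i)"
  using homeomorphic_imp_injective_map[OF homeo_coord] unfolding topspace_cdom .

lemma coord_in: "x \<in> cdom M i \<Longrightarrow> coord M i x \<in> cimg M i"
  by (simp add: cimg_def)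

lemma cinv_coord [simp]: "x \<in> cdom M i \<Longrightarrow> cinv M i (coord M i x) = x"
  by (simp add: cinv_def inv_into_f_f inj_coord)

lemma cinv_in: "p \<in> cimg M i \<Longrightarrow> cinv M i p \<in> cdom M i"
  by (simp add: cinv_def cimg_def inv_into_into)

lemma coord_cinv [simp]: "p \<in> cimg M i \<Longrightarrow> coord M i (cinv M i p) = p"
  by (simp add: cinv_def cimg_def f_inv_into_f)

lemma coord_image_subset: "U \<subseteq> cdom M i \<Longrightarrow> coord M i ` U \<subseteq> cimg M i"
  by (auto simp: cimg_def)

lemma open_coord_image:
  assumes "openin (mtop M) U" "U \<subseteq> cdom M i"
  shows "open (coord M i ` U)"
proof -
  have "openin (subtopology (mtop M) (cdom M i)) U"
    using assms by (simp add: openin_open_subtopology openin_cdom)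
  then have "openin (top_of_set (cimg M i)) (coord M i ` U)"
    using homeomorphic_map_openness_eq[OF homeo_coord] by blast
  then show ?thesis
    using openin_open_eq[OF open_cimg] by blast
qed

lemma compact_coord_image:
  assumes "compactin (mtop M) C" "C \<subseteq> cdom M i"
  shows "compact (coord M i ` C)"
proof -
  have "compactin (subtopology (mtop M) (cdom M i)) C"
    using assms by (simp add: compactin_subtopology)
  then have "compactin (top_of_set (cimg M i)) (coord M i ` C)"
    by (rule image_compactin[OF _ homeomorphic_imp_continuous_map[OF homeo_coord]])
  then show ?thesis
    by (simp add: compactin_subtopology)
qed

lemma homeo_cinv: "homeomorphic_map (top_of_set (cimg M i)) (subtopology (mtop M) (cdom M i)) (cinv M i)"
proof -
  obtain g where g: "homeomorphic_maps (subtopology (mtop M) (cdom M i)) (top_of_set (cimg M i)) (coord M i) g"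
    using homeo_coord homeomorphic_map_maps by blast
  then have "homeomorphic_map (top_of_set (cimg M i)) (subtopology (mtop M) (cdom M i)) g"
    using homeomorphic_maps_map by blast
  moreover have "g p = cinv M i p" if "p \<in> cimg M i" for p
  proof -
    have "g (coord M i (cinv M i p)) = cinv M i p"
      using g cinv_in[OF that] unfolding homeomorphic_maps_def topspace_cdom by blast
    then show ?thesis
      using that by simp
  qed
  ultimately show ?thesis
    by (rule homeomorphic_map_eq) simp
qed

lemma compactin_cinv_image:
  assumes "compact K" "K \<subseteq> cimg M i"
  shows "compactin (mtop M) (cinv M i ` K)"
proof -
  have "compactin (top_of_set (cimg M i)) K"
    using assms by (simp add: compactin_subtopology)
  then have "compactin (subtopology (mtop M) (cdom M i)) (cinv M i ` K)"
    by (rule image_compactin[OF _ homeomorphic_imp_continuous_map[OF homeo_cinv]])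
  then show ?thesis
    by (simp add: compactin_subtopology)
qed

lemma openin_cinv_image:
  assumes "open B" "B \<subseteq> cimg M i"
  shows "openin (mtop M) (cinv M i ` B)"
proof -
  have "openin (top_of_set (cimg M i)) B"
    using assms by (simp add: open_subset)
  then have "openin (subtopology (mtop M) (cdom M i)) (cinv M i ` B)"
    using homeomorphic_map_openness_eq[OF homeo_cinv] by blast
  then show ?thesis
    using openin_open_subtopology[OF openin_cdom] by blast
qed

lemma openin_Diff_compactin: "openin (mtop M) U \<Longrightarrow> compactin (mtop M) C \<Longrightarrow> openin (mtop M) (U - C)"
  using compactin_imp_closedin[OF Hausdorff] openin_diff by blast

lemma open_overlap: "open (coord M i ` (cdom M i \<inter> cdom M j))"
  by (intro open_coord_image openin_Int openin_cdom) auto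

lemma transition_coord: "x \<in> cdom M i \<Longrightarrow> transition M i j (coord M i x) = coord M j x"
  by (simp add: transition_def)

lemma transition_has_derivative:
  assumes "x \<in> cdom M i \<inter> cdom M j"
  shows "(transition M i j has_derivative tangent_change M i j x) (at (coord M i x))"
  unfolding tangent_change_def
  by (rule C1_on_has_derivative[OF smooth_on_imp_C1_on[OF smooth_transition]]) (use assms in blast)

lemma linear_tangent_change: "x \<in> cdom M i \<inter> cdom M j \<Longrightarrow> linear (tangent_change M i j x)"
  using transition_has_derivative has_derivative_linear by blast

section \<open>Functions on the manifold, bump functions and partitions of unity\<close>

definition C1_fun :: "('a \<Rightarrow> real) \<Rightarrow> bool" where
  "C1_fun f \<longleftrightarrow> (\<forall>i. C1_on (cimg M i) (\<lambda>p. f (cinv M i p)))"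

definition continuous_fun :: "('a \<Rightarrow> real) \<Rightarrow> bool" where
  "continuous_fun f \<longleftrightarrow> (\<forall>i. continuous_on (cimg M i) (\<lambda>p. f (cinv M i p)))"

lemma C1_fun_imp_continuous: "C1_fun f \<Longrightarrow> continuous_fun f"
  unfolding C1_fun_def continuous_fun_def using C1_on_continuous by blast

lemma continuous_fun_mult: "continuous_fun f \<Longrightarrow> continuous_fun g \<Longrightarrow> continuous_fun (\<lambda>x. f x * g x)"
  unfolding continuous_fun_def by (auto intro: continuous_on_mult)

text \<open>By the chain rule, df(v) depends only on the tangent vector and not on the chart in
  which it is written. This makes the derivative along a vector field a function on
  \<open>M\<close>.\<close>

lemma fderiv_change_chart:
  assumes f: "C1_fun f" and x: "x \<in> cdom M i \<inter> cdom M j"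
  shows "fderiv (\<lambda>p. f (cinv M i p)) (coord M i x) v
    = fderiv (\<lambda>p. f (cinv M j p)) (coord M j x) (tangent_change M i j x v)"
proof -
  have "fderiv (\<lambda>p. f (cinv M i p)) (coord M i x)
      = fderiv (\<lambda>p. f (cinv M j (transition M i j p))) (coord M i x)"
    by (rule fderiv_cong_open[OF open_overlap[of i j]]) (use x in \<open>auto simp: transition_coord\<close>)
  also have "\<dots> = (\<lambda>v. fderiv (\<lambda>p. f (cinv M j p)) (transition M i j (coord M i x)) (tangent_change M i j x v))"
    by (rule fderiv_eq, rule has_derivative_compose[OF transition_has_derivative[OF x]],
        rule C1_on_has_derivative[of "cimg M j"])
      (use f x in \<open>auto simp: C1_fun_def transition_coord coord_in\<close>)
  finally show ?thesis
    using x by (simp add: transition_coord)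
qed

text \<open>Compact sets are closed in a Hausdorff space, so the chart minus \<open>C\<close> is
  open and \<open>f\<close> vanishes in a neighbourhood of \<open>x\<close>.\<close>

lemma fderiv_zero_outside_support:
  assumes C: "compactin (mtop M) C" "\<And>y. y \<notin> C \<Longrightarrow> f y = 0" and x: "x \<in> cdom M i - C"
  shows "fderiv (\<lambda>p. f (cinv M i p)) (coord M i x) v = 0"
proof -
  have "open (coord M i ` (cdom M i - C))"
    by (intro open_coord_image openin_Diff_compactin openin_cdom C(1)) auto
  then have "fderiv (\<lambda>p. f (cinv M i p)) (coord M i x) = fderiv (\<lambda>_. 0) (coord M i x)"
    by (rule fderiv_cong_open) (use x C(2) in auto)
  then show ?thesis by simp
qed

text \<open>The squared positive part of \<open>r\<^sup>2 - (q - p) \<bullet> (q - p)\<close> in a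
  chart around \<open>x\<close>, extended by 0. The support lies in the image \<open>C\<close> of
  the closed ball, and \<open>U\<close> is the image of the open ball.\<close>

lemma C1_bump:
  assumes "x \<in> topspace (mtop M)"
  obtains i C U f where "C1_fun f" "\<And>y. f y \<ge> 0" "compactin (mtop M) C" "C \<subseteq> cdom M i"
    "\<And>y. y \<notin> C \<Longrightarrow> f y = 0" "openin (mtop M) U" "x \<in> U" "\<And>y. y \<in> U \<Longrightarrow> f y > 0"
proof -
  obtain i where x: "x \<in> cdom M i"
    using assms cover by blast
  define p where "p = coord M i x"
  obtain r where r: "r > 0" "cball p r \<subseteq> cimg M i"
    using open_cimg coord_in[OF x] open_contains_cball p_def by blast
  define b where "b q = (max 0 (r\<^sup>2 - (q - p) \<bullet> (q - p)))\<^sup>2" for q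
  define f where "f y = (if y \<in> cdom M i then b (coord M i y) else 0)" for y
  define C where "C = cinv M i ` cball p r"
  have inner_less: "(q - p) \<bullet> (q - p) < r\<^sup>2 \<longleftrightarrow> q \<in> ball p r" for q
    using r(1) by (simp add: dist_norm norm_minus_commute norm_lt_square flip: power2_norm_eq_inner)
  have Cb: "C1_on UNIV b"
    unfolding b_def
  proof (intro C1_on_max_0_squared C1_on_diff C1_on_const)
    show "C1_on UNIV (\<lambda>q. (q - p) \<bullet> (q - p))"
      by (rule C1_onI[where f'="\<lambda>q v. 2 * ((q - p) \<bullet> v)"])
        (auto intro!: derivative_eq_intros continuous_intros simp: inner_commute)
  qed
  have C: "compactin (mtop M) C"
    unfolding C_def by (rule compactin_cinv_image[OF compact_cball r(2)])
  have Csub: "C \<subseteq> cdom M i"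
    unfolding C_def using r(2) cinv_in by blast
  have f0: "f y = 0" if "y \<notin> C" for y
  proof (cases "y \<in> cdom M i")
    case True
    have "coord M i y \<notin> cball p r"
      using that cinv_coord[OF True] unfolding C_def by (metis imageI)
    then have "\<not> (coord M i y - p) \<bullet> (coord M i y - p) < r\<^sup>2"
      unfolding inner_less by auto
    then show ?thesis
      by (simp add: f_def b_def)
  qed (simp add: f_def)
  have "C1_on (cimg M j) (\<lambda>q. f (cinv M j q))" for j
  proof -
    \<comment> \<open>On \<open>A\<close> the coordinate formula applies, on \<open>B\<close> the
      function is 0. Both sets are open, \<open>B\<close> because the compact \<open>C\<close> is
      closed, and they cover the image of chart \<open>j\<close> because \<open>C\<close> lies in
      chart \<open>i\<close>.\<close>
    define A where "A = coord M j ` (cdom M j \<inter> cdom M i)"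
    define B where "B = coord M j ` (cdom M j - C)"
    have "open A"
      unfolding A_def by (rule open_overlap)
    have "open B"
      unfolding B_def by (intro open_coord_image openin_Diff_compactin openin_cdom C) auto
    have "C1_on A (\<lambda>q. b (transition M j i q))"
      unfolding A_def
      by (rule C1_on_compose[OF smooth_on_imp_C1_on[OF smooth_transition] Cb]) auto
    then have "C1_on A (\<lambda>q. f (cinv M j q))"
      by (subst C1_on_cong[OF \<open>open A\<close>, where g="\<lambda>q. b (transition M j i q)"])
        (auto simp: A_def f_def transition_coord)
    moreover have "C1_on B (\<lambda>q. f (cinv M j q))"
      by (subst C1_on_cong[OF \<open>open B\<close>, where g="\<lambda>q. 0"]) (auto simp: B_def f0 intro: C1_on_const)
    moreover have "cimg M j = A \<union> B"
      unfolding A_def B_def cimg_def using Csub by blast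
    ultimately show ?thesis
      using C1_on_Un \<open>open A\<close> \<open>open B\<close> by metis
  qed
  then have "C1_fun f"
    unfolding C1_fun_def by blast
  moreover have "f y \<ge> 0" for y
    by (simp add: f_def b_def)
  moreover have "openin (mtop M) (cinv M i ` ball p r)"
    by (rule openin_cinv_image) (use r(2) ball_subset_cball in auto)
  moreover have "x \<in> cinv M i ` ball p r"
    by (rule image_eqI[of _ _ p]) (use r(1) x in \<open>auto simp: p_def\<close>)
  moreover have "f y > 0" if y: "y \<in> cinv M i ` ball p r" for y
  proof -
    from y obtain q where q: "q \<in> ball p r" "y = cinv M i q"
      by blast
    then have "q \<in> cimg M i"
      using r(2) ball_subset_cball by blast
    moreover have "(q - p) \<bullet> (q - p) < r\<^sup>2"
      using q(1) inner_less by blast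
    ultimately show ?thesis
      using q(2) by (simp add: f_def b_def cinv_in)
  qed
  ultimately show thesis
    using that C Csub f0 by blast
qed

text \<open>Finitely many bumps whose positivity sets cover \<open>M\<close> are divided by their
  sum. They are indexed by the points around which they were built, whence \<open>N\<close> is a set
  of points.\<close>

lemma C1_partition_of_unity:
  assumes "compact_space (mtop M)"
  obtains N :: "'a set" and \<phi> i C where "finite N"
    "\<And>k. k \<in> N \<Longrightarrow> C1_fun (\<phi> k)" "\<And>k y. k \<in> N \<Longrightarrow> \<phi> k y \<ge> 0"
    "\<And>k. k \<in> N \<Longrightarrow> compactin (mtop M) (C k)" "\<And>k. k \<in> N \<Longrightarrow> C k \<subseteq> cdom M (i k)"
    "\<And>k y. k \<in> N \<Longrightarrow> y \<notin> C k \<Longrightarrow> \<phi> k y = 0"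
    "\<And>y. y \<in> topspace (mtop M) \<Longrightarrow> (\<Sum>k\<in>N. \<phi> k y) = 1"
proof -
  have "\<forall>x\<in>topspace (mtop M). \<exists>i C U f. C1_fun f \<and> (\<forall>y. f y \<ge> 0) \<and> compactin (mtop M) C \<and>
      C \<subseteq> cdom M i \<and> (\<forall>y. y \<notin> C \<longrightarrow> f y = 0) \<and> openin (mtop M) U \<and> x \<in> U \<and> (\<forall>y\<in>U. f y > 0)"
    using C1_bump by metis
  then obtain i C U \<psi> where *: "\<forall>x\<in>topspace (mtop M). C1_fun (\<psi> x) \<and> (\<forall>y. \<psi> x y \<ge> 0) \<and>
      compactin (mtop M) (C x) \<and> C x \<subseteq> cdom M (i x) \<and> (\<forall>y. y \<notin> C x \<longrightarrow> \<psi> x y = 0) \<and>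
      openin (mtop M) (U x) \<and> x \<in> U x \<and> (\<forall>y\<in>U x. \<psi> x y > 0)"
    unfolding bchoice_iff by blast
  have bump: "C1_fun (\<psi> x)" "\<psi> x y \<ge> 0" "compactin (mtop M) (C x)" "C x \<subseteq> cdom M (i x)"
      "y \<notin> C x \<Longrightarrow> \<psi> x y = 0" "openin (mtop M) (U x)" "x \<in> U x" "y \<in> U x \<Longrightarrow> \<psi> x y > 0"
    if "x \<in> topspace (mtop M)" for x y
    using * that by blast+
  have "\<exists>\<F>. finite \<F> \<and> \<F> \<subseteq> U ` topspace (mtop M) \<and> topspace (mtop M) \<subseteq> \<Union>\<F>"
  proof (rule compactinD)
    show "compactin (mtop M) (topspace (mtop M))"
      using assms unfolding compact_space_def .
    show "topspace (mtop M) \<subseteq> \<Union>(U ` topspace (mtop M))"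
      by (rule subsetI, rule UN_I, assumption, erule bump(7))
    show "openin (mtop M) V" if "V \<in> U ` topspace (mtop M)" for V
      using that bump(6) by (elim imageE) simp
  qed
  then obtain \<F> where \<F>: "finite \<F>" "\<F> \<subseteq> U ` topspace (mtop M)" "topspace (mtop M) \<subseteq> \<Union>\<F>"
    by blast
  from finite_subset_image[OF \<F>(1,2)] obtain N where
    N: "finite N" "N \<subseteq> topspace (mtop M)" "topspace (mtop M) \<subseteq> (\<Union>k\<in>N. U k)"
    using \<F>(3) by blast
  \<comment> \<open>Outside \<open>topspace (mtop M)\<close> the sum is 0 and so is every quotient
    by it, so the sign and support conditions hold at all \<open>y\<close>.\<close>
  define \<sigma> where "\<sigma> y = (\<Sum>k\<in>N. \<psi> k y)" for y
  have pos: "\<sigma> y > 0" if y: "y \<in> topspace (mtop M)" for y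
  proof -
    from y obtain k where "k \<in> N" "y \<in> U k"
      using N(3) by blast
    then show ?thesis
      unfolding \<sigma>_def using N bump(2,8) by (intro sum_pos2[of N k]) auto
  qed
  show thesis
  proof (rule that[of N "\<lambda>k y. \<psi> k y / \<sigma> y" C i])
    show "C1_fun (\<lambda>y. \<psi> k y / \<sigma> y)" if "k \<in> N" for k
      unfolding C1_fun_def \<sigma>_def
    proof (intro allI C1_on_divide C1_on_sum)
      fix j p assume "p \<in> cimg M j"
      then show "(\<Sum>k\<in>N. \<psi> k (cinv M j p)) \<noteq> 0"
        using pos cinv_in cdom_subset unfolding \<sigma>_def by (metis less_irrefl subsetD)
    qed (use bump(1) N(2) that in \<open>auto simp: C1_fun_def\<close>)
    show "(\<Sum>k\<in>N. \<psi> k y / \<sigma> y) = 1" if "y \<in> topspace (mtop M)" for y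
      using pos[OF that] unfolding sum_divide_distrib[symmetric] \<sigma>_def[symmetric] by simp
    show "\<psi> k y / \<sigma> y \<ge> 0" if "k \<in> N" for k y
      unfolding \<sigma>_def using bump(2) N(2) that by (intro divide_nonneg_nonneg sum_nonneg) auto
    show "C k \<subseteq> cdom M (i k)" if "k \<in> N" for k
      by (rule bump(4)) (use that N(2) in blast)
  qed (use bump N in auto)
qed

end

section \<open>Exact symplectic forms on compact manifolds\<close>

text \<open>\<open>om_closed\<close> stands beside \<open>om_exact\<close> because \<open>al\<close>
  is only C1: its second derivatives, through which d(d al) = 0 would be proved, need not exist.
  Antisymmetry of \<open>om\<close> is contained in \<open>om_exact\<close>.\<close>

locale exact_symplectic_manifold = manifold_charts M
  for M :: "('a, 'i, 'e::euclidean_space) manifold" +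
  fixes om :: "('a, 'i, 'e) bilinear_field" and al :: "'i \<Rightarrow> 'a \<Rightarrow> 'e \<Rightarrow> real"
  assumes bilinear_om: "\<And>i x. x \<in> cdom M i \<Longrightarrow> bilinear (om i x)"
    and linear_al: "\<And>i x. x \<in> cdom M i \<Longrightarrow> linear (al i x)"
    and C1_om: "\<And>i v w. C1_on (cimg M i) (\<lambda>p. om i (cinv M i p) v w)"
    and C1_al: "\<And>i w. C1_on (cimg M i) (\<lambda>p. al i (cinv M i p) w)"
    and om_change: "\<And>i j x v w. x \<in> cdom M i \<inter> cdom M j \<Longrightarrow>
      om j x (tangent_change M i j x v) (tangent_change M i j x w) = om i x v w"
    and al_change: "\<And>i j x w. x \<in> cdom M i \<inter> cdom M j \<Longrightarrow>
      al j x (tangent_change M i j x w) = al i x w"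
    and om_exact: "\<And>i p v w. p \<in> cimg M i \<Longrightarrow> om i (cinv M i p) v w
      = fderiv (\<lambda>q. al i (cinv M i q) w) p v - fderiv (\<lambda>q. al i (cinv M i q) v) p w"
    and om_closed: "closed_2form M om"
    and om_nondegenerate: "\<And>i x v. x \<in> cdom M i \<Longrightarrow> (\<And>w. om i x v w = 0) \<Longrightarrow> v = 0"
begin

definition om_matrix :: "'i \<Rightarrow> 'a \<Rightarrow> real ^ 'e basis_index ^ 'e basis_index" where
  "om_matrix i x = (\<chi> a b. om i x (basis_vec a) (basis_vec b))"

text \<open>This is the absolute value of the Pfaffian, that is, of the coefficient of the Liouville
  volume form \<open>om\<close>^n / n! in the coordinates.\<close>

definition vol_density :: "'i \<Rightarrow> 'a \<Rightarrow> real" where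
  "vol_density i x = sqrt \<bar>det (om_matrix i x)\<bar>"

lemma om_basis_sum:
  assumes "x \<in> cdom M i"
  shows "om i x (\<Sum>a\<in>UNIV. f a *\<^sub>R basis_vec a) (\<Sum>b\<in>UNIV. g b *\<^sub>R basis_vec b)
    = (\<Sum>a\<in>UNIV. \<Sum>b\<in>UNIV. f a * g b * om i x (basis_vec a) (basis_vec b))"
  using bilinear_sum[OF bilinear_om[OF assms], of "\<lambda>a. f a *\<^sub>R basis_vec a" UNIV "\<lambda>b. g b *\<^sub>R basis_vec b" UNIV]
  by (simp add: sum.cartesian_product bilinear_lmul[OF bilinear_om[OF assms]]
      bilinear_rmul[OF bilinear_om[OF assms]] ac_simps)

lemma linear_om: "x \<in> cdom M i \<Longrightarrow> linear (om i x v)" "x \<in> cdom M i \<Longrightarrow> linear (\<lambda>v. om i x v w)"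
  using bilinear_om unfolding bilinear_def by blast+

text \<open>A kernel vector of the transposed matrix is the coordinate vector of some
  \<open>v\<close> with om(v, w) = 0 for every \<open>w\<close>. Nondegeneracy concerns the first
  argument, whence the transpose.\<close>

lemma det_om_matrix:
  assumes x: "x \<in> cdom M i"
  shows "det (om_matrix i x) \<noteq> 0"
proof -
  have "y = 0" if "transpose (om_matrix i x) *v y = 0" for y
  proof -
    have "om i x (of_coords y) (basis_vec b) = 0" for b
      using arg_cong[OF that, of "\<lambda>z. z $ b"]
      by (simp add: of_coords_def linear_sum[OF linear_om(2)[OF x]] linear_scale[OF linear_om(2)[OF x]]
          matrix_vector_mult_def transpose_def om_matrix_def mult.commute)
    then have "om i x (of_coords y) w = 0" for w
      by (subst euclidean_representation_index[of w, symmetric])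
        (simp add: linear_sum[OF linear_om(1)[OF x]] linear_scale[OF linear_om(1)[OF x]])
    then have "of_coords y = 0"
      using om_nondegenerate[OF x] by blast
    then show ?thesis
      by (metis linear_0 linear_to_coords to_coords_of_coords)
  qed
  then have "\<exists>B. B ** transpose (om_matrix i x) = mat 1"
    unfolding matrix_left_invertible_ker by blast
  then have "invertible (transpose (om_matrix i x))"
    by (metis invertible_def matrix_left_right_inverse)
  then show ?thesis
    by (simp add: invertible_det_nz det_transpose)
qed

lemma vol_density_pos: "x \<in> cdom M i \<Longrightarrow> vol_density i x > 0"
  using det_om_matrix by (simp add: vol_density_def)

text \<open>The matrix of a bilinear form changes by congruence, so its determinant picks up the
  square of det T. The square root leaves the absolute Jacobian of the change of variables formula,
  and no orientation is involved.\<close>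

lemma vol_density_change:
  assumes x: "x \<in> cdom M i \<inter> cdom M j"
  shows "vol_density i x = \<bar>det (coord_matrix (tangent_change M i j x))\<bar> * vol_density j x"
proof -
  let ?T = "tangent_change M i j x"
  have T: "?T (basis_vec b) = (\<Sum>a\<in>UNIV. coord_matrix ?T $ a $ b *\<^sub>R basis_vec a)" for b
    by (simp add: coord_matrix_def euclidean_representation_index)
  have "om_matrix i x = transpose (coord_matrix ?T) ** om_matrix j x ** coord_matrix ?T"
  proof -
    have "om i x (basis_vec a) (basis_vec b)
      = (\<Sum>k\<in>UNIV. \<Sum>l\<in>UNIV. coord_matrix ?T $ k $ a * coord_matrix ?T $ l $ b * om_matrix j x $ k $ l)" for a b
    proof -
      have "om i x (basis_vec a) (basis_vec b) = om j x (?T (basis_vec a)) (?T (basis_vec b))"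
        using om_change[OF x] by simp
      also have "\<dots> = (\<Sum>k\<in>UNIV. \<Sum>l\<in>UNIV. coord_matrix ?T $ k $ a * coord_matrix ?T $ l $ b * om_matrix j x $ k $ l)"
        unfolding T using x by (subst om_basis_sum) (auto simp: om_matrix_def)
      finally show ?thesis .
    qed
    also have "(\<Sum>k\<in>UNIV. \<Sum>l\<in>UNIV. coord_matrix ?T $ k $ a * coord_matrix ?T $ l $ b * om_matrix j x $ k $ l)
      = (transpose (coord_matrix ?T) ** om_matrix j x ** coord_matrix ?T) $ a $ b" for a b
      unfolding matrix_matrix_mult_def transpose_def vec_lambda_beta sum_distrib_right
      by (subst sum.swap) (simp add: ac_simps)
    finally show ?thesis
      by (simp add: vec_eq_iff om_matrix_def)
  qed
  then have "det (om_matrix i x) = (det (coord_matrix ?T))\<^sup>2 * det (om_matrix j x)"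
    by (simp add: det_mul det_transpose power2_eq_square)
  then show ?thesis
    by (simp add: vol_density_def abs_mult real_sqrt_mult)
qed

section \<open>The Liouville vector field\<close>

definition liouville :: "'i \<Rightarrow> 'e \<Rightarrow> 'e basis_index \<Rightarrow> real" where
  "liouville = (SOME V. \<forall>i. (\<forall>k. C1_on (cimg M i) (\<lambda>p. V i p k)) \<and>
    (\<forall>p\<in>cimg M i. \<forall>b. (\<Sum>k\<in>UNIV. V i p k * om i (cinv M i p) (basis_vec k) (basis_vec b))
      = al i (cinv M i p) (basis_vec b)) \<and>
    (\<forall>p\<in>cimg M i. (\<Sum>k\<in>UNIV. fderiv (\<lambda>q. V i q k * vol_density i (cinv M i q)) p (basis_vec k))
      = real DIM('e) / 2 * vol_density i (cinv M i p)))"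

definition liouville_vec :: "'i \<Rightarrow> 'e \<Rightarrow> 'e" where
  "liouville_vec i p = (\<Sum>k\<in>UNIV. liouville i p k *\<^sub>R basis_vec k)"

text \<open>In each chart this is \<open>liouville_field\<close>, applied to the components of
  \<open>om\<close> and \<open>al\<close>. Nondegeneracy makes the contraction equation uniquely
  solvable, so on the chart image the choice in \<open>liouville\<close> is no real choice, and the
  fields of different charts will match.\<close>

lemma liouville:
  shows C1_liouville: "C1_on (cimg M i) (\<lambda>p. liouville i p k)"
    and liouville_contract: "p \<in> cimg M i \<Longrightarrow>
      (\<Sum>k\<in>UNIV. liouville i p k * om i (cinv M i p) (basis_vec k) (basis_vec b)) = al i (cinv M i p) (basis_vec b)"
    and liouville_divergence: "p \<in> cimg M i \<Longrightarrow>
      (\<Sum>k\<in>UNIV. fderiv (\<lambda>q. liouville i q k * vol_density i (cinv M i q)) p (basis_vec k))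
      = real DIM('e) / 2 * vol_density i (cinv M i p)"
proof -
  have "\<forall>i. \<exists>V. (\<forall>k. C1_on (cimg M i) (\<lambda>p. V p k)) \<and>
    (\<forall>p\<in>cimg M i. \<forall>b. (\<Sum>k\<in>UNIV. V p k * om i (cinv M i p) (basis_vec k) (basis_vec b))
      = al i (cinv M i p) (basis_vec b)) \<and>
    (\<forall>p\<in>cimg M i. (\<Sum>k\<in>UNIV. fderiv (\<lambda>q. V q k * vol_density i (cinv M i q)) p (basis_vec k))
      = real DIM('e) / 2 * vol_density i (cinv M i p))"
  proof
    fix i
    obtain V where "\<And>k. C1_on (cimg M i) (V k)"
      "\<And>b p. p \<in> cimg M i \<Longrightarrow> (\<Sum>k\<in>UNIV. V k p * om i (cinv M i p) (basis_vec k) (basis_vec b))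
        = al i (cinv M i p) (basis_vec b)"
      "\<And>p. p \<in> cimg M i \<Longrightarrow> (\<Sum>k\<in>UNIV. fderiv (\<lambda>q. V k q *
          sqrt \<bar>det (\<chi> a b. om i (cinv M i q) (basis_vec a) (basis_vec b))\<bar>) p (basis_vec k))
        = real DIM('e) / 2 * sqrt \<bar>det (\<chi> a b. om i (cinv M i p) (basis_vec a) (basis_vec b))\<bar>"
    proof (rule liouville_field[where S="cimg M i" and W="\<lambda>a b p. om i (cinv M i p) (basis_vec a) (basis_vec b)"
          and a="\<lambda>b p. al i (cinv M i p) (basis_vec b)"])
      show "fderiv (\<lambda>p. om i (cinv M i p) (basis_vec a) (basis_vec b)) p (basis_vec k)
          + fderiv (\<lambda>p. om i (cinv M i p) (basis_vec b) (basis_vec k)) p (basis_vec a)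
          + fderiv (\<lambda>p. om i (cinv M i p) (basis_vec k) (basis_vec a)) p (basis_vec b) = 0"
        if "p \<in> cimg M i" for a b k p
        using om_closed that unfolding closed_2form_def by blast
      show "det (\<chi> a b. om i (cinv M i p) (basis_vec a) (basis_vec b)) \<noteq> 0" if "p \<in> cimg M i" for p
        using det_om_matrix[OF cinv_in[OF that]] unfolding om_matrix_def .
    qed (auto intro: open_cimg C1_om C1_al om_exact)
    then show "\<exists>V. (\<forall>k. C1_on (cimg M i) (\<lambda>p. V p k)) \<and>
      (\<forall>p\<in>cimg M i. \<forall>b. (\<Sum>k\<in>UNIV. V p k * om i (cinv M i p) (basis_vec k) (basis_vec b))
        = al i (cinv M i p) (basis_vec b)) \<and>
      (\<forall>p\<in>cimg M i. (\<Sum>k\<in>UNIV. fderiv (\<lambda>q. V q k * vol_density i (cinv M i q)) p (basis_vec k))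
        = real DIM('e) / 2 * vol_density i (cinv M i p))"
      unfolding vol_density_def om_matrix_def by (intro exI[of _ "\<lambda>p k. V k p"]) blast
  qed
  from someI_ex[OF choice[OF this]] show "C1_on (cimg M i) (\<lambda>p. liouville i p k)"
    and "p \<in> cimg M i \<Longrightarrow>
      (\<Sum>k\<in>UNIV. liouville i p k * om i (cinv M i p) (basis_vec k) (basis_vec b)) = al i (cinv M i p) (basis_vec b)"
    and "p \<in> cimg M i \<Longrightarrow>
      (\<Sum>k\<in>UNIV. fderiv (\<lambda>q. liouville i q k * vol_density i (cinv M i q)) p (basis_vec k))
      = real DIM('e) / 2 * vol_density i (cinv M i p)"
    unfolding liouville_def by blast+
qed

lemma continuous_liouville_vec: "continuous_on (cimg M i) (liouville_vec i)"
  unfolding liouville_vec_def by (intro continuous_intros C1_on_continuous C1_liouville)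

lemma C1_vol_density: "C1_on (cimg M i) (\<lambda>p. vol_density i (cinv M i p))"
proof -
  have "C1_on (cimg M i) (\<lambda>p. det (om_matrix i (cinv M i p)))"
    unfolding om_matrix_def by (intro C1_on_det C1_om)
  then show ?thesis
    unfolding vol_density_def by (rule C1_on_sqrt_abs(1)) (use det_om_matrix cinv_in in blast)
qed

lemma om_liouville_vec:
  assumes x: "x \<in> cdom M i"
  shows "om i x (liouville_vec i (coord M i x)) w = al i x w"
proof -
  note om1 = linear_om(1)[OF x] and om2 = linear_om(2)[OF x] and al = linear_al[OF x]
  have "om i x (liouville_vec i (coord M i x)) (basis_vec b) = al i x (basis_vec b)" for b
    using liouville_contract[OF coord_in[OF x], of b] x
    by (simp add: liouville_vec_def linear_sum[OF om2] linear_scale[OF om2])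
  then show ?thesis
    by (subst (1 2) euclidean_representation_index[of w, symmetric])
      (simp only: linear_sum[OF om1] linear_scale[OF om1] linear_sum[OF al] linear_scale[OF al])
qed

text \<open>Both vectors contract with \<open>om\<close> in chart \<open>j\<close> to the same
  covector \<open>al\<close>, so nondegeneracy identifies them. The tangent change is injective
  because it pulls \<open>om\<close> back to a nondegenerate form, hence surjective, and every test
  vector can be written as \<open>?T u\<close>.\<close>

lemma liouville_vec_change:
  assumes x: "x \<in> cdom M i \<inter> cdom M j"
  shows "tangent_change M i j x (liouville_vec i (coord M i x)) = liouville_vec j (coord M j x)"
proof -
  let ?T = "tangent_change M i j x"
  have lin: "linear ?T"
    by (rule linear_tangent_change[OF x])
  have xi: "x \<in> cdom M i" and xj: "x \<in> cdom M j"
    using x by auto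
  have "v = 0" if "?T v = 0" for v
  proof (rule om_nondegenerate[OF xi])
    show "om i x v w = 0" for w
      using om_change[OF x, of v w] that linear_0[OF linear_om(2)[OF xj]] by simp
  qed
  then have "inj ?T"
    using linear_injective_0[OF lin] by blast
  then have surj: "surj ?T"
    using linear_injective_imp_surjective[OF lin] by blast
  have "om j x (?T (liouville_vec i (coord M i x)) - liouville_vec j (coord M j x)) w = 0" for w
  proof -
    obtain u where u: "w = ?T u"
      using surj by blast
    show ?thesis
      by (simp add: linear_diff[OF linear_om(2)[OF xj]] om_liouville_vec[OF xj])
        (simp add: u om_change[OF x] al_change[OF x] om_liouville_vec[OF xi])
  qed
  then show ?thesis
    using om_nondegenerate[OF xj] by fastforce
qed

text \<open>The derivative of \<open>f\<close> along the Liouville field as a function on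
  \<open>M\<close>. For \<open>f\<close> of class C1 the arbitrary chart may be replaced by any
  other chart around \<open>x\<close>.\<close>

definition liouville_deriv :: "('a \<Rightarrow> real) \<Rightarrow> 'a \<Rightarrow> real" where
  "liouville_deriv f x = (let i = (SOME i. x \<in> cdom M i) in
    fderiv (\<lambda>p. f (cinv M i p)) (coord M i x) (liouville_vec i (coord M i x)))"

lemma liouville_deriv_eq:
  assumes f: "C1_fun f" and x: "x \<in> cdom M i"
  shows "liouville_deriv f x = fderiv (\<lambda>p. f (cinv M i p)) (coord M i x) (liouville_vec i (coord M i x))"
proof -
  define j where "j = (SOME i. x \<in> cdom M i)"
  have "x \<in> cdom M j"
    unfolding j_def using x by (rule someI)
  then have "x \<in> cdom M j \<inter> cdom M i"
    using x by blast
  from fderiv_change_chart[OF f this] liouville_vec_change[OF this] show ?thesis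
    unfolding liouville_deriv_def Let_def j_def[symmetric] by simp
qed

lemma continuous_liouville_deriv:
  assumes "C1_fun f"
  shows "continuous_fun (liouville_deriv f)"
  unfolding continuous_fun_def
proof
  fix i
  have "continuous_on (cimg M i) (\<lambda>p. fderiv (\<lambda>p. f (cinv M i p)) p (liouville_vec i p))"
    by (rule C1_on_fderiv_continuous_field[of "cimg M i"])
      (use assms in \<open>auto simp: C1_fun_def continuous_liouville_vec\<close>)
  then show "continuous_on (cimg M i) (\<lambda>p. liouville_deriv f (cinv M i p))"
    by (simp add: liouville_deriv_eq[OF assms cinv_in] cong: continuous_on_cong)
qed

lemma liouville_deriv_outside_support:
  assumes f: "C1_fun f" and C: "compactin (mtop M) C" "\<And>y. y \<notin> C \<Longrightarrow> f y = 0"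
    and x: "x \<in> topspace (mtop M) - C"
  shows "liouville_deriv f x = 0"
proof -
  obtain i where i: "x \<in> cdom M i"
    using x cover by blast
  show ?thesis
    unfolding liouville_deriv_eq[OF f i]
    by (rule fderiv_zero_outside_support[where C=C]) (use C x i in auto)
qed

section \<open>Integration against the Liouville density\<close>

definition chart_integral :: "'i \<Rightarrow> ('a \<Rightarrow> real) \<Rightarrow> real" where
  "chart_integral i f = integral (cimg M i) (\<lambda>p. f (cinv M i p) * vol_density i (cinv M i p))"

lemma chart_has_integral:
  assumes f: "continuous_fun f" and C: "compactin (mtop M) C" "C \<subseteq> cdom M i"
    and f0: "\<And>x. x \<in> cdom M i - C \<Longrightarrow> f x = 0"
  shows "((\<lambda>p. f (cinv M i p) * vol_density i (cinv M i p)) has_integral chart_integral i f) (coord M i ` C)"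
    and "((\<lambda>p. f (cinv M i p) * vol_density i (cinv M i p)) has_integral chart_integral i f) (cimg M i)"
proof -
  let ?F = "\<lambda>p. f (cinv M i p) * vol_density i (cinv M i p)"
  have "continuous_on (cimg M i) ?F"
    using f C1_on_continuous[OF C1_vol_density] unfolding continuous_fun_def by (intro continuous_on_mult) auto
  then have "continuous_on (coord M i ` C) ?F"
    using coord_image_subset[OF C(2)] continuous_on_subset by blast
  then have "?F absolutely_integrable_on (coord M i ` C)"
    by (rule absolutely_integrable_compact[OF compact_coord_image[OF C]])
  then have "?F integrable_on (coord M i ` C)"
    using absolutely_integrable_on_def by blast
  then obtain I where I: "(?F has_integral I) (coord M i ` C)"
    by blast
  have eq: "(if p \<in> coord M i ` C then ?F p else 0) = (if p \<in> cimg M i then ?F p else 0)" for p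
  proof (cases "p \<in> cimg M i \<and> p \<notin> coord M i ` C")
    case True
    then have "cinv M i p \<in> cdom M i - C"
      using cinv_in coord_cinv by (metis DiffI imageI)
    then show ?thesis
      by (simp add: f0)
  qed (use coord_image_subset[OF C(2)] in auto)
  have "((\<lambda>p. if p \<in> coord M i ` C then ?F p else 0) has_integral I) UNIV"
    using I by (simp only: has_integral_restrict_UNIV)
  then have "(?F has_integral I) (cimg M i)"
    unfolding eq by (simp only: has_integral_restrict_UNIV)
  moreover from this have "chart_integral i f = I"
    unfolding chart_integral_def by (rule integral_unique)
  ultimately show "(?F has_integral chart_integral i f) (coord M i ` C)"
    "(?F has_integral chart_integral i f) (cimg M i)"
    using I by auto
qed

text \<open>The transition map carries one coordinate image of \<open>C\<close> onto the other, and
  its absolute Jacobian is absorbed by \<open>vol_density_change\<close>.\<close>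

lemma chart_integral_change:
  assumes f: "continuous_fun f" and C: "compactin (mtop M) C" "C \<subseteq> cdom M i \<inter> cdom M j"
    and f0: "\<And>x. x \<in> topspace (mtop M) - C \<Longrightarrow> f x = 0"
  shows "chart_integral i f = chart_integral j f"
proof -
  let ?F = "\<lambda>i p. f (cinv M i p) * vol_density i (cinv M i p)"
  have Ci: "C \<subseteq> cdom M i" and Cj: "C \<subseteq> cdom M j"
    using C(2) by auto
  have img: "transition M i j ` coord M i ` C = coord M j ` C"
    unfolding image_image using Ci by (intro image_cong) (auto simp: transition_coord)
  have "chart_integral j f = integral (coord M j ` C) (?F j)"
    by (rule integral_unique[symmetric], rule chart_has_integral(1)[OF f C(1) Cj])
      (use f0 cdom_subset in blast)
  also have "\<dots> = integral (coord M i ` C) (\<lambda>p. \<bar>det (coord_matrix (tangent_change M i j (cinv M i p)))\<bar>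
      * ?F j (transition M i j p))"
    unfolding img[symmetric]
  proof (rule integral_change_of_variables[OF compact_coord_image[OF C(1) Ci]])
    show "(transition M i j has_derivative tangent_change M i j (cinv M i p)) (at p)"
      if "p \<in> coord M i ` C" for p
    proof -
      obtain x where x: "x \<in> C" "p = coord M i x"
        using \<open>p \<in> coord M i ` C\<close> by blast
      then have "x \<in> cdom M i \<inter> cdom M j"
        using C(2) by blast
      with transition_has_derivative[OF this] x show ?thesis
        by simp
    qed
    show "inj_on (transition M i j) (coord M i ` C)"
    proof (rule inj_onI)
      fix p q assume "p \<in> coord M i ` C" "q \<in> coord M i ` C" and eq: "transition M i j p = transition M i j q"
      then obtain x y where xy: "x \<in> C" "y \<in> C" "p = coord M i x" "q = coord M i y"
        by blast
      moreover from this have "x \<in> cdom M i" "y \<in> cdom M i"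
        using Ci by blast+
      ultimately have "coord M j x = coord M j y"
        using eq by (simp add: transition_coord)
      then have "x = y"
        using xy Cj inj_coord[of j] by (meson inj_onD subsetD)
      then show "p = q"
        using xy by simp
    qed
    have "continuous_on (cimg M j) (?F j)"
      using f C1_on_continuous[OF C1_vol_density] unfolding continuous_fun_def by (intro continuous_on_mult) auto
    then show "continuous_on (transition M i j ` coord M i ` C) (?F j)"
      unfolding img using coord_image_subset[OF Cj] continuous_on_subset by blast
  qed
  also have "\<dots> = integral (coord M i ` C) (?F i)"
  proof (rule integral_cong)
    fix p assume "p \<in> coord M i ` C"
    then obtain x where x: "x \<in> C" "p = coord M i x"
      by blast
    then have "x \<in> cdom M i \<inter> cdom M j"
      using C(2) by blast
    with vol_density_change[OF this] x show "\<bar>det (coord_matrix (tangent_change M i j (cinv M i p)))\<bar>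
      * ?F j (transition M i j p) = ?F i p"
      by (simp add: transition_coord)
  qed
  also have "\<dots> = chart_integral i f"
    by (rule integral_unique, rule chart_has_integral(1)[OF f C(1) Ci]) (use f0 cdom_subset in blast)
  finally show ?thesis by simp
qed

text \<open>With \<rho> the density, \<open>liouville_divergence\<close> gives div(f \<rho> V) = (V
  f) \<rho> + (DIM / 2) f \<rho>, and the integral of the left side is 0 since f has compact support
  in the chart.\<close>

lemma chart_stokes:
  assumes f: "C1_fun f" and C: "compactin (mtop M) C" "C \<subseteq> cdom M i" and f0: "\<And>x. x \<notin> C \<Longrightarrow> f x = 0"
  shows "chart_integral i (liouville_deriv f) = - (real DIM('e) / 2) * chart_integral i f"
proof -
  let ?f = "\<lambda>p. f (cinv M i p)" and ?\<rho> = "\<lambda>p. vol_density i (cinv M i p)"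
  define V where "V k p = liouville i p k * ?\<rho> p" for k p
  \<comment> \<open>The extension by 0 is C1 on the whole space: it vanishes on the open complement
    of the compact set \<open>K\<close>, which together with the chart image covers
    everything.\<close>
  define F where "F k p = (if p \<in> cimg M i then ?f p * V k p else 0)" for k p
  define K where "K = coord M i ` C"
  have K: "compact K" "K \<subseteq> cimg M i"
    unfolding K_def using compact_coord_image[OF C] coord_image_subset[OF C(2)] by auto
  have f0': "?f p = 0" if "p \<in> cimg M i - K" for p
    using that coord_cinv f0 unfolding K_def by (metis DiffD1 DiffD2 imageI)
  have Cf: "C1_on (cimg M i) ?f"
    using f unfolding C1_fun_def by blast
  have CV: "C1_on (cimg M i) (V k)" for k
    unfolding V_def by (intro C1_on_mult C1_liouville C1_vol_density)
  have F0: "F k p = 0" if "p \<notin> K" for k p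
    using that f0' by (auto simp: F_def)
  have open_K: "open (- K)"
    using K(1) compact_imp_closed by blast
  have CF: "C1_on UNIV (F k)" for k
  proof -
    have "C1_on (cimg M i) (F k)"
      by (subst C1_on_cong[OF open_cimg, where g="\<lambda>p. ?f p * V k p"])
        (auto simp: F_def intro: C1_on_mult Cf CV)
    moreover have "C1_on (- K) (F k)"
      by (subst C1_on_cong[OF open_K, where g="\<lambda>p. 0"]) (auto simp: F0 intro: C1_on_const)
    moreover have "cimg M i \<union> - K = UNIV"
      using K(2) by blast
    ultimately show ?thesis
      using C1_on_Un[OF open_cimg open_K] by metis
  qed
  have "((\<lambda>p. \<Sum>k\<in>UNIV. fderiv (F k) p (basis_vec k)) has_integral (\<Sum>k\<in>(UNIV :: 'e basis_index set). 0)) UNIV"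
    by (intro has_integral_sum integral_fderiv_compact_support[OF CF K(1) F0]) auto
  moreover have "(\<Sum>k\<in>UNIV. fderiv (F k) p (basis_vec k)) = (if p \<in> cimg M i then
      liouville_deriv f (cinv M i p) * ?\<rho> p + real DIM('e) / 2 * (?f p * ?\<rho> p) else 0)" for p
  proof (cases "p \<in> cimg M i")
    case True
    have "fderiv (F k) p v = ?f p * fderiv (V k) p v + fderiv ?f p v * V k p" for k v
    proof -
      have "fderiv (F k) p = fderiv (\<lambda>p. ?f p * V k p) p"
        by (rule fderiv_cong_open[OF open_cimg True]) (simp add: F_def)
      also have "\<dots> = (\<lambda>v. ?f p * fderiv (V k) p v + fderiv ?f p v * V k p)"
        by (rule fderiv_eq, intro has_derivative_mult C1_on_has_derivative[OF _ True] Cf CV)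
      finally show ?thesis by simp
    qed
    then have "(\<Sum>k\<in>UNIV. fderiv (F k) p (basis_vec k)) =
        ?f p * (\<Sum>k\<in>UNIV. fderiv (V k) p (basis_vec k)) + (\<Sum>k\<in>UNIV. liouville i p k * fderiv ?f p (basis_vec k)) * ?\<rho> p"
      by (simp add: sum.distrib V_def sum_distrib_left sum_distrib_right ac_simps)
    also have "(\<Sum>k\<in>UNIV. fderiv (V k) p (basis_vec k)) = real DIM('e) / 2 * ?\<rho> p"
      unfolding V_def by (rule liouville_divergence[OF True])
    also have "(\<Sum>k\<in>UNIV. liouville i p k * fderiv ?f p (basis_vec k)) = liouville_deriv f (cinv M i p)"
    proof -
      have lin: "linear (fderiv ?f p)"
        by (rule C1_on_linear_fderiv[OF Cf True])
      show ?thesis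
        using True
        by (simp add: liouville_deriv_eq[OF f cinv_in[OF True]] liouville_vec_def linear_sum[OF lin] linear_scale[OF lin])
    qed
    finally show ?thesis
      using True by simp
  next
    case False
    then have "p \<in> - K"
      using K(2) by blast
    then have "fderiv (F k) p = fderiv (\<lambda>_. 0) p" for k
      by (intro fderiv_cong_open[OF open_K]) (auto simp: F0)
    then show ?thesis
      using False by simp
  qed
  ultimately have "((\<lambda>p. liouville_deriv f (cinv M i p) * ?\<rho> p + real DIM('e) / 2 * (?f p * ?\<rho> p)) has_integral 0) (cimg M i)"
    by (simp only: has_integral_restrict_UNIV sum.neutral_const)
  moreover have "((\<lambda>p. liouville_deriv f (cinv M i p) * ?\<rho> p + real DIM('e) / 2 * (?f p * ?\<rho> p)) has_integral
      chart_integral i (liouville_deriv f) + real DIM('e) / 2 * chart_integral i f) (cimg M i)"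
    by (intro has_integral_add has_integral_mult_right chart_has_integral(2)[OF _ C]
        continuous_liouville_deriv f C1_fun_imp_continuous)
      (use f0 liouville_deriv_outside_support[OF f C(1) f0] cdom_subset in blast)+
  ultimately have "chart_integral i (liouville_deriv f) + real DIM('e) / 2 * chart_integral i f = 0"
    by (rule has_integral_unique[rotated])
  then show ?thesis
    by linarith
qed

lemma chart_integral_nonneg_eq_0:
  assumes f: "continuous_fun f" and C: "compactin (mtop M) C" "C \<subseteq> cdom M i"
    and f0: "\<And>x. x \<in> cdom M i - C \<Longrightarrow> f x = 0" and nonneg: "\<And>x. f x \<ge> 0"
    and int: "chart_integral i f = 0" and x: "x \<in> cdom M i"
  shows "f x = 0"
proof -
  let ?F = "\<lambda>p. f (cinv M i p) * vol_density i (cinv M i p)"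
  obtain a b where ab: "coord M i x \<in> box a b" "cbox a b \<subseteq> cimg M i"
    using open_contains_cbox[of "cimg M i"] open_cimg coord_in[OF x] by metis
  have cont: "continuous_on (cimg M i) ?F"
    using f C1_on_continuous[OF C1_vol_density] unfolding continuous_fun_def by (intro continuous_on_mult) auto
  have pos: "?F p \<ge> 0" if "p \<in> cimg M i" for p
    using nonneg vol_density_pos[OF cinv_in[OF that]] by (intro mult_nonneg_nonneg) auto
  have contab: "continuous_on (cbox a b) ?F"
    using cont ab(2) continuous_on_subset by blast
  then obtain I where I: "(?F has_integral I) (cbox a b)"
    using integrable_continuous by blast
  have F0: "(?F has_integral 0) (cimg M i)"
    using chart_has_integral(2)[OF f C f0] unfolding int .
  have "I \<le> 0"
    by (rule has_integral_subset_le[OF ab(2) I F0]) (use pos in blast)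
  moreover have "I \<ge> 0"
    by (rule has_integral_nonneg[OF I]) (use pos ab(2) in blast)
  ultimately have I0: "(?F has_integral 0) (cbox a b)"
    using I by simp
  have "?F (coord M i x) = 0"
  proof (rule has_integral_0_cbox_imp_0[OF contab _ I0])
    show "0 \<le> ?F p" if "p \<in> box a b" for p
      by (rule pos) (use that ab(2) box_subset_cbox in blast)
  qed (use ab(1) box_subset_cbox in auto)
  then show ?thesis
    using x vol_density_pos[OF x] by simp
qed

text \<open>Integrating \<open>L\<^sub>V\<close> of a partition of unity: the total vanishes because \<open>L\<^sub>V 1 = 0\<close>, while Stokes in
  each chart makes it a negative multiple of the total volume.\<close>
lemma compact_imp_empty:
  assumes compact: "compact_space (mtop M)"
  shows "topspace (mtop M) = {}"
proof (rule ccontr)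
  assume nonempty: "topspace (mtop M) \<noteq> {}"
  obtain N :: "'a set" and \<phi> C i where N: "finite N"
    and C1: "\<And>k. k \<in> N \<Longrightarrow> C1_fun (\<phi> k)" and nonneg: "\<And>k y. k \<in> N \<Longrightarrow> \<phi> k y \<ge> 0"
    and C: "\<And>k. k \<in> N \<Longrightarrow> compactin (mtop M) (C k)" "\<And>k. k \<in> N \<Longrightarrow> C k \<subseteq> cdom M (i k)"
    and supp: "\<And>k y. k \<in> N \<Longrightarrow> y \<notin> C k \<Longrightarrow> \<phi> k y = 0"
    and one: "\<And>y. y \<in> topspace (mtop M) \<Longrightarrow> (\<Sum>k\<in>N. \<phi> k y) = 1"
    by (rule C1_partition_of_unity[OF compact]) blast
  let ?L = "\<lambda>k. liouville_deriv (\<phi> k)"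
  have cont: "continuous_fun (\<phi> k)" "continuous_fun (?L k)" if "k \<in> N" for k
    using C1[OF that] C1_fun_imp_continuous continuous_liouville_deriv by blast+
  have Lsupp: "?L k y = 0" if "k \<in> N" "y \<in> topspace (mtop M) - C k" for k y
    by (rule liouville_deriv_outside_support[OF C1 C(1) supp]) (use that in blast)+
  \<comment> \<open>The functions add up to the constant 1, whose derivative is 0.\<close>
  have sum_L: "(\<Sum>k\<in>N. ?L k y) = 0" if y: "y \<in> topspace (mtop M)" for y
  proof -
    from y obtain j where j: "y \<in> cdom M j"
      unfolding cover[symmetric] by blast
    define q where "q = coord M j y"
    have q: "q \<in> cimg M j"
      unfolding q_def by (rule coord_in[OF j])
    have "fderiv (\<lambda>p. \<Sum>k\<in>N. \<phi> k (cinv M j p)) q = (\<lambda>v. \<Sum>k\<in>N. fderiv (\<lambda>p. \<phi> k (cinv M j p)) q v)"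
      by (rule fderiv_eq, rule has_derivative_sum, rule C1_on_has_derivative[OF _ q])
        (use C1 in \<open>simp add: C1_fun_def\<close>)
    moreover have "fderiv (\<lambda>p. \<Sum>k\<in>N. \<phi> k (cinv M j p)) q = fderiv (\<lambda>_. 1) q"
      by (rule fderiv_cong_open[OF open_cimg q], rule one) (use cinv_in cdom_subset in blast)
    ultimately have "(\<Sum>k\<in>N. fderiv (\<lambda>p. \<phi> k (cinv M j p)) q (liouville_vec j q)) = 0"
      by (metis frechet_derivative_const)
    then show ?thesis
      unfolding q_def using liouville_deriv_eq[OF C1 j] by simp
  qed
  have chart_sum: "chart_integral j (\<lambda>y. \<Sum>l\<in>N. g l y) = (\<Sum>l\<in>N. chart_integral j (g l))"
    if g: "\<And>l. l \<in> N \<Longrightarrow> continuous_fun (g l)" "compactin (mtop M) D" "D \<subseteq> cdom M j"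
      and g0: "\<And>l y. l \<in> N \<Longrightarrow> y \<in> topspace (mtop M) - D \<Longrightarrow> g l y = 0" for j g D
  proof -
    have "((\<lambda>p. \<Sum>l\<in>N. g l (cinv M j p) * vol_density j (cinv M j p)) has_integral
        (\<Sum>l\<in>N. chart_integral j (g l))) (cimg M j)"
      by (intro has_integral_sum N chart_has_integral(2)[OF g(1,2,3)]) (use g0 cdom_subset in blast)+
    then show ?thesis
      unfolding chart_integral_def[of j "\<lambda>y. \<Sum>l\<in>N. g l y"] sum_distrib_right by (rule integral_unique)
  qed
  have chart_cong: "chart_integral j f = chart_integral j g"
    if "\<And>y. y \<in> topspace (mtop M) \<Longrightarrow> f y = g y" for j f g
    unfolding chart_integral_def
    by (rule integral_cong) (use that cinv_in cdom_subset in \<open>metis subsetD\<close>)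
  \<comment> \<open>Inserting the partition of unity splits each integral into pieces supported in
    the intersection of \<open>C k\<close> and \<open>C l\<close>, hence in two charts at
    once.\<close>
  have "(\<Sum>k\<in>N. chart_integral (i k) (?L k)) = (\<Sum>k\<in>N. \<Sum>l\<in>N. chart_integral (i k) (\<lambda>y. \<phi> l y * ?L k y))"
  proof (rule sum.cong[OF refl])
    fix k assume k: "k \<in> N"
    have "chart_integral (i k) (?L k) = chart_integral (i k) (\<lambda>y. \<Sum>l\<in>N. \<phi> l y * ?L k y)"
      by (rule chart_cong) (simp add: one flip: sum_distrib_right)
    also have "\<dots> = (\<Sum>l\<in>N. chart_integral (i k) (\<lambda>y. \<phi> l y * ?L k y))"
      by (rule chart_sum[OF _ C[OF k]]) (simp_all add: continuous_fun_mult cont k Lsupp)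
    finally show "chart_integral (i k) (?L k) = (\<Sum>l\<in>N. chart_integral (i k) (\<lambda>y. \<phi> l y * ?L k y))" .
  qed
  \<comment> \<open>Each piece moves to the chart of \<open>l\<close>. There the sum over
    \<open>k\<close> can be carried out under the integral, where it meets
    \<open>sum_L\<close>.\<close>
  also have "\<dots> = (\<Sum>k\<in>N. \<Sum>l\<in>N. chart_integral (i l) (\<lambda>y. \<phi> l y * ?L k y))"
  proof (intro sum.cong refl)
    fix k l assume kl: "k \<in> N" "l \<in> N"
    show "chart_integral (i k) (\<lambda>y. \<phi> l y * ?L k y) = chart_integral (i l) (\<lambda>y. \<phi> l y * ?L k y)"
    proof (rule chart_integral_change[where C="C k \<inter> C l"])
      show "compactin (mtop M) (C k \<inter> C l)"
        by (intro closed_Int_compactin compactin_imp_closedin[OF Hausdorff] C(1) kl)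
      show "continuous_fun (\<lambda>y. \<phi> l y * ?L k y)"
        by (intro continuous_fun_mult cont kl)
      show "C k \<inter> C l \<subseteq> cdom M (i k) \<inter> cdom M (i l)"
        using C(2)[OF kl(1)] C(2)[OF kl(2)] by blast
      show "\<phi> l y * ?L k y = 0" if "y \<in> topspace (mtop M) - (C k \<inter> C l)" for y
        using that Lsupp[OF kl(1), of y] supp[OF kl(2), of y] by auto
    qed
  qed
  also have "\<dots> = (\<Sum>l\<in>N. \<Sum>k\<in>N. chart_integral (i l) (\<lambda>y. \<phi> l y * ?L k y))"
    by (rule sum.swap)
  also have "\<dots> = (\<Sum>l\<in>N. chart_integral (i l) (\<lambda>y. \<Sum>k\<in>N. \<phi> l y * ?L k y))"
  proof (rule sum.cong[OF refl], rule sym)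
    fix l assume l: "l \<in> N"
    show "chart_integral (i l) (\<lambda>y. \<Sum>k\<in>N. \<phi> l y * ?L k y) = (\<Sum>k\<in>N. chart_integral (i l) (\<lambda>y. \<phi> l y * ?L k y))"
      by (rule chart_sum[OF _ C[OF l]]) (simp_all add: continuous_fun_mult cont l supp)
  qed
  also have "\<dots> = (\<Sum>l\<in>N. chart_integral (i l) (\<lambda>y. 0))"
    by (intro sum.cong refl chart_cong) (simp add: sum_L flip: sum_distrib_left)
  also have "\<dots> = 0"
    by (simp add: chart_integral_def)
  finally have "(\<Sum>k\<in>N. - (real DIM('e) / 2) * chart_integral (i k) (\<phi> k)) = 0"
    using chart_stokes[OF C1 C supp] by simp
  \<comment> \<open>The dimension is positive in the class \<open>euclidean_space\<close>, so the
    factor cancels.\<close>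
  then have sum0: "(\<Sum>k\<in>N. chart_integral (i k) (\<phi> k)) = 0"
    unfolding sum_distrib_left[symmetric] by simp
  have nonneg_int: "chart_integral (i k) (\<phi> k) \<ge> 0" if k: "k \<in> N" for k
  proof (rule has_integral_nonneg[OF chart_has_integral(2)[OF cont(1)[OF k] C[OF k]]])
    show "\<phi> k x = 0" if "x \<in> cdom M (i k) - C k" for x
      using that supp[OF k] by blast
    show "0 \<le> \<phi> k (cinv M (i k) p) * vol_density (i k) (cinv M (i k) p)" if "p \<in> cimg M (i k)" for p
      by (intro mult_nonneg_nonneg nonneg k less_imp_le vol_density_pos cinv_in that)
  qed
  have zero: "chart_integral (i k) (\<phi> k) = 0" if "k \<in> N" for k
    using sum_nonneg_eq_0_iff[THEN iffD1, OF N nonneg_int sum0] that by blast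
  have "\<phi> k y = 0" if k: "k \<in> N" for k y
  proof (cases "y \<in> C k")
    case True
    then have y: "y \<in> cdom M (i k)"
      using C(2)[OF k] by blast
    have supp': "\<phi> k x = 0" if "x \<in> cdom M (i k) - C k" for x
      using that supp[OF k] by blast
    show ?thesis
      by (rule chart_integral_nonneg_eq_0[OF cont(1)[OF k] C[OF k] supp' nonneg[OF k] zero[OF k] y])
  qed (use supp[OF k] in blast)
  then have "(\<Sum>k\<in>N. \<phi> k y) = 0" for y
    by (intro sum.neutral ballI)
  moreover from nonempty obtain y where y: "y \<in> topspace (mtop M)"
    unfolding ex_in_conv[symmetric] by (rule exE)
  ultimately show False
    using one[OF y] by simp
qed

end

section \<open>Integrals depending on a parameter\<close>

text \<open>Differentiation under the integral. \<open>leibniz_rule\<close> wants the derivative as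
  a continuous family of bounded linear maps; in finite dimension its continuity is tested on basis
  vectors. The parameter \<open>t\<close> enters as a complex number because \<open>f\<close> will
  be a function on an affine chart of the twistor space.\<close>

lemma C1_on_parameter_integral:
  fixes f :: "'e::euclidean_space \<times> complex \<Rightarrow> real"
  assumes S: "open S" and f: "C1_on (S \<times> UNIV) f"
  shows "C1_on S (\<lambda>p. integral {-1..1} (\<lambda>t. f (p, of_real t)))"
    and "p \<in> S \<Longrightarrow> fderiv (\<lambda>p. integral {-1..1} (\<lambda>t. f (p, of_real t))) p v
      = integral {-1..1} (\<lambda>t. fderiv f (p, of_real t) (v, 0))"
proof -
  define f' where "f' p t v = fderiv f (p, of_real t) (v, 0)" for p :: 'e and t :: real and v :: 'e
  define fx where "fx p t = Blinfun (f' p t)" for p t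
  have contf': "continuous_on (S \<times> T) (\<lambda>(p, t). f' p t v)" for v T
    unfolding f'_def case_prod_unfold
    by (rule continuous_on_compose2[OF C1_on_fderiv_continuous[OF f]]) (auto intro!: continuous_intros)
  have der: "((\<lambda>p. f (p, of_real t)) has_derivative f' p t) (at p)" if "p \<in> S" for p t
    unfolding f'_def
    by (rule has_derivative_compose[where f="\<lambda>p. (p, of_real t)", OF _ C1_on_has_derivative[OF f]])
      (use that in \<open>auto intro!: derivative_eq_intros\<close>)
  have fx: "blinfun_apply (fx p t) = f' p t" if "p \<in> S" for p t
    unfolding fx_def by (rule bounded_linear_Blinfun_apply) (rule has_derivative_bounded_linear[OF der[OF that]])
  have contfx: "continuous_on (S \<times> T) (\<lambda>(p, t). fx p t)" for T
  proof (rule continuous_on_blinfun_componentwise)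
    fix b :: 'e
    show "continuous_on (S \<times> T) (\<lambda>x. blinfun_apply (case x of (p, t) \<Rightarrow> fx p t) b)"
      using contf'[of T b] by (rule continuous_on_eq) (auto simp: fx)
  qed
  have contf: "continuous_on T (\<lambda>t. f (p, of_real t))" if "p \<in> S" for p and T :: "real set"
    by (rule continuous_on_compose2[OF C1_on_continuous[OF f]]) (use that in \<open>auto intro!: continuous_intros\<close>)
  have int_der: "((\<lambda>p. integral {-1..1} (\<lambda>t. f (p, of_real t))) has_derivative
      (\<lambda>v. integral {-1..1} (\<lambda>t. f' p t v))) (at p)" if p: "p \<in> S" for p
  proof -
    \<comment> \<open>The ball supplies the convex neighbourhood on which
      \<open>leibniz_rule\<close> works.\<close>
    from S p obtain r where r: "r > 0" "ball p r \<subseteq> S"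
      using open_contains_ball by blast
    have "((\<lambda>p. integral (cbox (- 1) 1) (\<lambda>t. f (p, of_real t))) has_derivative
        blinfun_apply (integral (cbox (- 1) 1) (fx p))) (at p within ball p r)"
    proof (rule leibniz_rule)
      show "((\<lambda>p. f (p, of_real t)) has_derivative blinfun_apply (fx q t)) (at q within ball p r)"
        if "q \<in> ball p r" for q t
        using der fx that r(2) has_derivative_at_withinI by (metis subsetD)
      show "(\<lambda>t. f (q, of_real t)) integrable_on cbox (- 1) 1" if "q \<in> ball p r" for q
        using that r(2) by (intro integrable_continuous contf) blast
      show "continuous_on (ball p r \<times> cbox (- 1) 1) (\<lambda>(p, t). fx p t)"
        by (rule continuous_on_subset[OF contfx[of UNIV]]) (use r(2) in auto)
    qed (use r(1) in auto)
    moreover have "blinfun_apply (integral (cbox (- 1) 1) (fx p)) v = integral {-1..1} (\<lambda>t. f' p t v)" for v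
    proof -
      have "continuous_on (cbox (- 1) 1) (fx p)"
      proof -
        have "continuous_on (cbox (- 1) 1) (\<lambda>t. case (p, t) of (p, t) \<Rightarrow> fx p t)"
          by (rule continuous_on_compose2[OF contfx[of UNIV]], intro continuous_intros) (use p in auto)
        then show ?thesis by simp
      qed
      then have "fx p integrable_on cbox (- 1) 1"
        by (rule integrable_continuous)
      from blinfun_apply_integral[OF this, of v] show ?thesis
        by (simp add: fx[OF p])
    qed
    then have "blinfun_apply (integral (cbox (- 1) 1) (fx p)) = (\<lambda>v. integral {-1..1} (\<lambda>t. f' p t v))"
      by (rule ext)
    ultimately show ?thesis
      using at_within_open[of p "ball p r"] r(1) by simp
  qed
  show "C1_on S (\<lambda>p. integral {-1..1} (\<lambda>t. f (p, of_real t)))"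
  proof (rule C1_onI[OF int_der])
    show "continuous_on S (\<lambda>p. integral {-1..1} (\<lambda>t. f' p t v))" for v
      using integral_continuous_on_param[of S "- 1" 1 "\<lambda>p t. f' p t v"] contf' by simp
  qed
  show "fderiv (\<lambda>p. integral {-1..1} (\<lambda>t. f (p, of_real t))) p v
      = integral {-1..1} (\<lambda>t. fderiv f (p, of_real t) (v, 0))" if "p \<in> S"
    unfolding fderiv_eq[OF int_der[OF that]] f'_def ..
qed

section \<open>The affine charts of the twistor space\<close>

context manifold_charts
begin

lemma cdom_twistor: "cdom (twistor_space M) (i, Affine) = cdom M i \<times> - {None}"
  by (simp add: twistor_space_def product_manifold_def riemann_sphere_def)

lemma coord_twistor: "coord (twistor_space M) (i, Affine) (x, Some z) = (coord M i x, z)"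
  by (simp add: twistor_space_def product_manifold_def riemann_sphere_def)

lemma cimg_twistor: "cimg (twistor_space M) (i, Affine) = cimg M i \<times> UNIV"
proof -
  have *: "z \<noteq> None \<longleftrightarrow> z \<in> range Some" for z :: "complex option"
    by (cases z) auto
  have "(- {None} :: complex option set) = range Some"
    by (intro set_eqI) (simp only: Compl_iff singleton_iff *)
  then show ?thesis
    unfolding cimg_def cdom_twistor by (force simp: coord_twistor)
qed

lemma cinv_twistor:
  assumes "p \<in> cimg M i"
  shows "cinv (twistor_space M) (i, Affine) (p, z) = (cinv M i p, Some z)"
  unfolding cinv_def[of "twistor_space M"]
proof (rule inv_into_f_eq)
  show "inj_on (coord (twistor_space M) (i, Affine)) (cdom (twistor_space M) (i, Affine))"
  proof (rule inj_onI)
    fix q q' assume "q \<in> cdom (twistor_space M) (i, Affine)" "q' \<in> cdom (twistor_space M) (i, Affine)"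
      and eq: "coord (twistor_space M) (i, Affine) q = coord (twistor_space M) (i, Affine) q'"
    then obtain x y z z' where "q = (x, Some z)" "q' = (y, Some z')" "x \<in> cdom M i" "y \<in> cdom M i"
      by (cases q; cases q'; cases "snd q"; cases "snd q'") (auto simp: cdom_twistor)
    then show "q = q'"
      using eq by (auto simp: coord_twistor dest: inj_onD[OF inj_coord])
  qed
qed (use assms cinv_in in \<open>auto simp: cdom_twistor coord_twistor\<close>)

text \<open>Between two affine charts the transition map is the one of \<open>M\<close> times the
  identity of the complex plane.\<close>

lemma tangent_change_twistor:
  assumes x: "x \<in> cdom M i \<inter> cdom M j"
  shows "tangent_change (twistor_space M) (i, Affine) (j, Affine) (x, Some z) (v, c) = (tangent_change M i j x v, c)"
proof -
  let ?A = "coord M i ` (cdom M i \<inter> cdom M j)"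
  have "fderiv (transition (twistor_space M) (i, Affine) (j, Affine)) (coord M i x, z)
      = fderiv (\<lambda>q. (transition M i j (fst q), snd q)) (coord M i x, z)"
  proof (rule fderiv_cong_open[of "?A \<times> UNIV"])
    show "open (?A \<times> (UNIV :: complex set))"
      by (intro open_Times open_overlap open_UNIV)
    show "transition (twistor_space M) (i, Affine) (j, Affine) q = (transition M i j (fst q), snd q)"
      if "q \<in> ?A \<times> UNIV" for q
      using that by (cases q) (auto simp: transition_def cinv_twistor coord_twistor coord_in)
  qed (use x in auto)
  also have "\<dots> = (\<lambda>v. (tangent_change M i j x (fst v), snd v))"
    by (rule fderiv_eq, intro has_derivative_Pair has_derivative_compose[where f=fst and g="transition M i j"])
      (auto intro!: derivative_eq_intros transition_has_derivative x)
  finally show ?thesis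
    unfolding tangent_change_def coord_twistor by simp
qed

end

section \<open>The Kaehler form of a twistor space\<close>

locale kaehler_twistor_space = manifold_charts X
  for X :: "('a, 'i, 'e::euclidean_space) manifold" +
  fixes I J K :: "('a, 'i, 'e) endo_field"
    and g :: "('a \<times> complex option, 'i \<times> sphere_chart, 'e \<times> complex) bilinear_field"
  assumes hypercomplex: "hypercomplex_manifold X I J K"
    and kaehler: "kaehler_metric (twistor_space X) (twistor_structure I J K) g"
begin

section \<open>The metric and the complex structures in the affine charts\<close>

abbreviation gz :: "'i \<Rightarrow> 'a \<Rightarrow> complex \<Rightarrow> 'e \<times> complex \<Rightarrow> 'e \<times> complex \<Rightarrow> real" where
  "gz i x z \<equiv> g (i, Affine) (x, Some z)"

abbreviation structure_at :: "complex \<Rightarrow> 'i \<Rightarrow> 'a \<Rightarrow> 'e \<Rightarrow> 'e" where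
  "structure_at z \<equiv> induced_structure I J K (Some z)"

lemma in_cdom_twistor: "x \<in> cdom X i \<Longrightarrow> (x, Some z) \<in> cdom (twistor_space X) (i, Affine)"
  by (simp add: cdom_twistor)

lemma metric:
  assumes "x \<in> cdom X i"
  shows bilinear_gz: "bilinear (gz i x z)"
    and gz_sym: "gz i x z v w = gz i x z w v"
    and gz_pos: "v \<noteq> 0 \<Longrightarrow> gz i x z v v > 0"
    and gz_hermitian: "gz i x z (twistor_structure I J K (i, Affine) (x, Some z) v)
      (twistor_structure I J K (i, Affine) (x, Some z) w) = gz i x z v w"
  using kaehler in_cdom_twistor[OF assms, of z]
  unfolding kaehler_metric_def hermitian_metric_def riemannian_metric_def smooth_bilinear_field_def
  by blast+

lemma gz_change:
  assumes "x \<in> cdom X i \<inter> cdom X j"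
  shows "gz j x z (tangent_change X i j x v, c) (tangent_change X i j x w, d) = gz i x z (v, c) (w, d)"
proof -
  have "(x, Some z) \<in> cdom (twistor_space X) (i, Affine) \<inter> cdom (twistor_space X) (j, Affine)"
    using assms in_cdom_twistor by blast
  then have "gz j x z (tangent_change (twistor_space X) (i, Affine) (j, Affine) (x, Some z) (v, c))
      (tangent_change (twistor_space X) (i, Affine) (j, Affine) (x, Some z) (w, d)) = gz i x z (v, c) (w, d)"
    using kaehler
    unfolding kaehler_metric_def hermitian_metric_def riemannian_metric_def smooth_bilinear_field_def
    by blast
  then show ?thesis
    by (simp add: tangent_change_twistor[OF assms])
qed

lemma open_cimg_UNIV: "open (cimg X i \<times> (UNIV :: complex set))"
  by (intro open_Times open_cimg open_UNIV)

lemma C1_gz: "C1_on (cimg X i \<times> UNIV) (\<lambda>q. gz i (cinv X i (fst q)) (snd q) v w)"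
proof -
  have "C1_on (cimg X i \<times> UNIV) (\<lambda>q. g (i, Affine) (cinv (twistor_space X) (i, Affine) q) v w)"
  proof (rule smooth_on_imp_C1_on)
    show "smooth_on (cimg X i \<times> UNIV) (\<lambda>q. g (i, Affine) (cinv (twistor_space X) (i, Affine) q) v w)"
      using kaehler
      unfolding kaehler_metric_def hermitian_metric_def riemannian_metric_def smooth_bilinear_field_def
        cimg_twistor[symmetric] by blast
  qed
  then show ?thesis
    by (subst C1_on_cong[OF open_cimg_UNIV, where g="\<lambda>q. g (i, Affine) (cinv (twistor_space X) (i, Affine) q) v w"])
      (auto simp: cinv_twistor)
qed

lemma complex_structures: "complex_structure X I" "complex_structure X J" "complex_structure X K"
  using hypercomplex unfolding hypercomplex_manifold_def by blast+

lemma complex_structureD: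
  assumes F: "complex_structure X F"
  shows complex_structure_linear: "x \<in> cdom X i \<Longrightarrow> linear (F i x)"
    and complex_structure_squared: "x \<in> cdom X i \<Longrightarrow> F i x (F i x v) = - v"
    and complex_structure_C1: "C1_on (cimg X i) (\<lambda>p. F i (cinv X i p) v)"
    and complex_structure_change: "x \<in> cdom X i \<inter> cdom X j \<Longrightarrow>
      tangent_change X i j x (F i x v) = F j x (tangent_change X i j x v)"
proof -
  show "C1_on (cimg X i) (\<lambda>p. F i (cinv X i p) v)"
    by (rule smooth_on_imp_C1_on) (use F in \<open>simp add: complex_structure_def smooth_endo_field_def\<close>)
qed (use F in \<open>unfold complex_structure_def smooth_endo_field_def, blast\<close>)+

lemmas linear_I = complex_structure_linear[OF complex_structures(1)]
  and linear_J = complex_structure_linear[OF complex_structures(2)]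
  and linear_K = complex_structure_linear[OF complex_structures(3)]
  and II = complex_structure_squared[OF complex_structures(1)]
  and JJ = complex_structure_squared[OF complex_structures(2)]
  and KK = complex_structure_squared[OF complex_structures(3)]

lemma quaternions:
  assumes "x \<in> cdom X i"
  shows IJ: "I i x (J i x v) = K i x v" and JK: "J i x (K i x v) = I i x v" and KI: "K i x (I i x v) = J i x v"
  using hypercomplex assms unfolding hypercomplex_manifold_def by blast+

lemma quaternions':
  assumes x: "x \<in> cdom X i"
  shows JI: "J i x (I i x v) = - K i x v" and KJ: "K i x (J i x v) = - I i x v" and IK: "I i x (K i x v) = - J i x v"
proof -
  show "J i x (I i x v) = - K i x v"
    using JJ[OF x, of "K i x v"] by (simp add: JK[OF x])
  show "K i x (J i x v) = - I i x v"
    using KK[OF x, of "I i x v"] by (simp add: KI[OF x])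
  show "I i x (K i x v) = - J i x v"
    using II[OF x, of "J i x v"] by (simp add: IJ[OF x])
qed

text \<open>For \<open>z = 1\<close> and \<open>z = -1\<close> the \<open>I\<close> component
  vanishes since \<open>z\<close> has modulus 1, and the \<open>K\<close> component since
  \<open>z\<close> is real.\<close>

lemma structure_at_1: "structure_at 1 i x v = J i x v"
  and structure_at_minus_1: "structure_at (- 1) i x v = - J i x v"
  by (simp_all add: induced_structure_def P1_to_sphere_def)

lemma structure_at_0_vec: "x \<in> cdom X i \<Longrightarrow> structure_at z i x 0 = 0"
  by (simp add: induced_structure_def case_prod_unfold linear_0[OF linear_I] linear_0[OF linear_J] linear_0[OF linear_K])

text \<open>The mixed products cancel by anticommutation, and the squares contribute a^2 + b^2 + c^2
  = 1.\<close>

lemma structure_at_squared: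
  assumes x: "x \<in> cdom X i"
  shows "structure_at z i x (structure_at z i x v) = - v"
proof -
  obtain a b c where abc: "P1_to_sphere (Some z) = (a, b, c)"
    by (cases "P1_to_sphere (Some z)")
  then have 1: "a * a + b * b + c * c = 1"
    using P1_to_sphere_in_unit_sphere[of "Some z"] by (simp add: unit_sphere_def power2_eq_square)
  note lin = linear_add linear_scale
  have "structure_at z i x (structure_at z i x v) = - ((a * a + b * b + c * c) *\<^sub>R v)"
    unfolding induced_structure_def abc prod.case
    by (simp add: lin[OF linear_I[OF x]] lin[OF linear_J[OF x]] lin[OF linear_K[OF x]]
        II[OF x] JJ[OF x] KK[OF x] IJ[OF x] JK[OF x] KI[OF x] JI[OF x] KJ[OF x] IK[OF x] algebra_simps)
  then show ?thesis
    by (simp add: 1)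
qed

text \<open>\<open>vert\<close> is the Kaehler form contracted with the real direction of the affine coordinate, \<open>horiz\<close> its
  restriction to the fibres.\<close>
definition vert :: "'i \<Rightarrow> 'e \<Rightarrow> 'e \<times> complex \<Rightarrow> real" where
  "vert i w q = gz i (cinv X i (fst q)) (snd q) (0, \<i>) (w, 0)"

definition horiz :: "'i \<Rightarrow> 'e \<Rightarrow> 'e \<Rightarrow> 'e \<times> complex \<Rightarrow> real" where
  "horiz i v w q = gz i (cinv X i (fst q)) (snd q) (structure_at (snd q) i (cinv X i (fst q)) v, 0) (w, 0)"

lemma C1_vert: "C1_on (cimg X i \<times> UNIV) (vert i w)"
  unfolding vert_def by (rule C1_gz)

lemma C1_fst: "C1_on A f \<Longrightarrow> C1_on (A \<times> UNIV) (\<lambda>q. f (fst q))" for f :: "'e \<Rightarrow> 'f::real_normed_vector"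
  by (rule C1_on_compose[OF C1_on_bounded_linear[OF bounded_linear_fst]]) auto

text \<open>The first argument of the metric varies with the point through the complex structure.
  Its coefficients are the rational functions of inverse stereographic projection, with denominator
  1 + |z|^2, and expanding it in the basis leaves the metric on constant vectors only.\<close>

lemma C1_horiz: "C1_on (cimg X i \<times> UNIV) (horiz i v w)"
proof -
  let ?S = "cimg X i \<times> (UNIV :: complex set)"
  let ?N = "\<lambda>q. structure_at (snd q) i (cinv X i (fst q)) v"
  let ?r = "\<lambda>q :: 'e \<times> complex. (Re (snd q))\<^sup>2 + (Im (snd q))\<^sup>2"
  have Re: "C1_on ?S (\<lambda>q. Re (snd q))" and Im: "C1_on ?S (\<lambda>q. Im (snd q))"
    by (intro C1_on_bounded_linear bounded_linear_compose[OF bounded_linear_Re bounded_linear_snd]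
        bounded_linear_compose[OF bounded_linear_Im bounded_linear_snd])+
  have r: "C1_on ?S ?r"
    unfolding power2_eq_square by (intro C1_on_add C1_on_mult Re Im)
  have nz: "1 + ?r q \<noteq> 0" for q
    using sum_power2_ge_zero[of "Re (snd q)" "Im (snd q)"] by linarith
  have N: "?N = (\<lambda>q. ((1 - ?r q) / (1 + ?r q)) *\<^sub>R I i (cinv X i (fst q)) v
      + (2 * Re (snd q) / (1 + ?r q)) *\<^sub>R J i (cinv X i (fst q)) v
      + (2 * Im (snd q) / (1 + ?r q)) *\<^sub>R K i (cinv X i (fst q)) v)"
    by (simp add: fun_eq_iff induced_structure_def P1_to_sphere_def cmod_power2)
  have "C1_on ?S ?N"
    unfolding N
    by (intro C1_on_add C1_on_scaleR C1_on_divide C1_on_diff C1_on_mult C1_on_const r Re Im nz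
        C1_fst complex_structure_C1 complex_structures)
  then have "C1_on ?S (\<lambda>q. \<Sum>b\<in>Basis. (?N q \<bullet> b) * gz i (cinv X i (fst q)) (snd q) (b, 0) (w, 0))"
    by (intro C1_on_sum C1_on_mult C1_on_inner C1_gz)
  moreover have "horiz i v w q = (\<Sum>b\<in>Basis. (?N q \<bullet> b) * gz i (cinv X i (fst q)) (snd q) (b, 0) (w, 0))"
    if "q \<in> ?S" for q
  proof -
    let ?x = "cinv X i (fst q)"
    have lin: "linear (\<lambda>u. gz i ?x (snd q) u (w, 0))"
      using bilinear_gz[OF cinv_in] that unfolding bilinear_def by force
    have "horiz i v w q = gz i ?x (snd q) (\<Sum>b\<in>Basis. (?N q \<bullet> b) *\<^sub>R (b, 0)) (w, 0)"
      unfolding horiz_def by (simp add: sum_prod euclidean_representation)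
    then show ?thesis
      by (simp only: linear_sum[OF lin] linear_scale[OF lin] real_scaleR_def)
  qed
  ultimately show ?thesis
    using C1_on_cong[OF open_cimg_UNIV] by (metis (no_types, lifting))
qed

definition form :: "'i \<Rightarrow> 'e \<times> complex \<Rightarrow> 'e \<times> complex \<Rightarrow> 'e \<times> complex \<Rightarrow> real" where
  "form i v w q = fundamental_form (twistor_structure I J K) g (i, Affine)
    (cinv (twistor_space X) (i, Affine) q) v w"

lemma form_horiz:
  "p \<in> cimg X i \<Longrightarrow> form i (v, 0) (w, 0) (p, z) = horiz i v w (p, z)"
  by (simp add: form_def fundamental_form_def cinv_twistor twistor_structure_def horiz_def)

text \<open>The complex structure of the base takes 1 to \<i>; this is the origin of the argument
  \<open>(0, \<i>)\<close> in \<open>vert\<close>.\<close>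

lemma form_vert:
  "p \<in> cimg X i \<Longrightarrow> form i (0, 1) (w, 0) (p, z) = vert i w (p, z)"
  by (simp add: form_def fundamental_form_def cinv_twistor twistor_structure_def vert_def structure_at_0_vec cinv_in)

text \<open>Antisymmetry of the Kaehler form: since F is an isometry with F F = -1, g(F u, v) = g(F
  F u, F v) = - g(u, F v).\<close>

lemma form_vert':
  assumes p: "p \<in> cimg X i"
  shows "form i (w, 0) (0, 1) (p, z) = - vert i w (p, z)"
proof -
  let ?x = "cinv X i p"
  let ?F = "twistor_structure I J K (i, Affine) (?x, Some z)"
  have x: "?x \<in> cdom X i"
    by (rule cinv_in[OF p])
  have "gz i ?x z (?F (w, 0)) (0, 1) = gz i ?x z (?F (?F (w, 0))) (?F (0, 1))"
    by (rule gz_hermitian[OF x, symmetric])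
  also have "\<dots> = gz i ?x z (- (w, 0)) (0, \<i>)"
    by (simp add: twistor_structure_def structure_at_squared[OF x] structure_at_0_vec[OF x])
  also have "\<dots> = - gz i ?x z (0, \<i>) (w, 0)"
    unfolding bilinear_lneg[OF bilinear_gz[OF x]] gz_sym[OF x, of z "(w, 0)"] ..
  finally show ?thesis
    using p by (simp add: form_def fundamental_form_def cinv_twistor vert_def)
qed

lemma closed_form:
  assumes "p \<in> cimg X i"
  shows "fderiv (form i v w) (p, z) u + fderiv (form i w u) (p, z) v + fderiv (form i u v) (p, z) w = 0"
proof -
  have "(p, z) \<in> cimg (twistor_space X) (i, Affine)"
    using assms by (simp add: cimg_twistor)
  then show ?thesis
    using kaehler unfolding kaehler_metric_def closed_2form_def form_def[abs_def] by blast
qed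

lemma fderiv_form:
  assumes p: "p \<in> cimg X i"
  shows fderiv_form_horiz: "fderiv (form i (v, 0) (w, 0)) (p, z) = fderiv (horiz i v w) (p, z)"
    and fderiv_form_vert: "fderiv (form i (0, 1) (w, 0)) (p, z) = fderiv (vert i w) (p, z)"
    and fderiv_form_vert': "fderiv (form i (w, 0) (0, 1)) (p, z) u = - fderiv (vert i w) (p, z) u"
proof -
  note cong = fderiv_cong_open[OF open_cimg_UNIV[of i], of "(p, z)"]
  show "fderiv (form i (v, 0) (w, 0)) (p, z) = fderiv (horiz i v w) (p, z)"
    by (rule cong) (use p form_horiz in auto)
  show "fderiv (form i (0, 1) (w, 0)) (p, z) = fderiv (vert i w) (p, z)"
    by (rule cong) (use p form_vert in auto)
  have "fderiv (form i (w, 0) (0, 1)) (p, z) = fderiv (\<lambda>q. - vert i w q) (p, z)"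
    by (rule cong) (use p form_vert' in auto)
  also have "\<dots> = (\<lambda>u. - fderiv (vert i w) (p, z) u)"
    by (rule fderiv_eq, rule has_derivative_minus, rule C1_on_has_derivative[OF C1_vert]) (use p in simp)
  finally show "fderiv (form i (w, 0) (0, 1)) (p, z) u = - fderiv (vert i w) (p, z) u"
    by simp
qed

lemma horiz_closed:
  assumes p: "p \<in> cimg X i"
  shows "fderiv (horiz i v w) (p, z) (u, 0) + fderiv (horiz i w u) (p, z) (v, 0) + fderiv (horiz i u v) (p, z) (w, 0) = 0"
  using closed_form[OF p, of "(v, 0)" "(w, 0)" z "(u, 0)"] by (simp only: fderiv_form_horiz[OF p])

text \<open>Closedness evaluated on two fibre directions and the real direction of the base. It says
  that the restrictions of the form to the fibres vary by the exterior derivative of the 1-form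
  \<open>vert\<close>.\<close>

lemma fderiv_horiz_vertical:
  assumes p: "p \<in> cimg X i"
  shows "fderiv (horiz i v w) (p, z) (0, 1) = fderiv (vert i w) (p, z) (v, 0) - fderiv (vert i v) (p, z) (w, 0)"
  using closed_form[OF p, of "(v, 0)" "(w, 0)" z "(0, 1)"]
  unfolding fderiv_form_horiz[OF p] fderiv_form_vert[OF p] fderiv_form_vert'[OF p] by linarith

section \<open>The exact symplectic form on the hypercomplex manifold\<close>

definition om :: "('a, 'i, 'e) bilinear_field" where
  "om i x v w = gz i x 1 (J i x v, 0) (w, 0) + gz i x (- 1) (J i x v, 0) (w, 0)"

text \<open>The homotopy operator of the Poincare lemma, applied to the Kaehler form along the
  segment.\<close>

definition al :: "'i \<Rightarrow> 'a \<Rightarrow> 'e \<Rightarrow> real" where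
  "al i x w = integral {-1..1} (\<lambda>t. gz i x (of_real t) (0, \<i>) (w, 0))"

lemma om_horiz:
  assumes p: "p \<in> cimg X i"
  shows "om i (cinv X i p) v w = horiz i v w (p, 1) - horiz i v w (p, - 1)"
proof -
  have neg: "(- u, 0) = - (u, 0 :: complex)" for u :: 'e
    by simp
  show ?thesis
    by (simp only: om_def horiz_def fst_conv snd_conv structure_at_1 structure_at_minus_1 neg
        bilinear_lneg[OF bilinear_gz[OF cinv_in[OF p]]] diff_minus_eq_add)
qed

lemma al_vert: "al i (cinv X i p) w = integral {-1..1} (\<lambda>t. vert i w (p, of_real t))"
  unfolding al_def vert_def by simp

lemma C1_slice: "C1_on (cimg X i \<times> UNIV) f \<Longrightarrow> C1_on (cimg X i) (\<lambda>p. f (p, z))" for f :: "'e \<times> complex \<Rightarrow> real"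
  by (rule C1_on_compose[OF C1_on_Pair[OF C1_on_bounded_linear[OF bounded_linear_ident] C1_on_const]]) auto

lemma fderiv_slice:
  fixes f :: "'e \<times> complex \<Rightarrow> real"
  assumes f: "C1_on (cimg X i \<times> UNIV) f" and p: "p \<in> cimg X i"
  shows "((\<lambda>p. f (p, z)) has_derivative (\<lambda>u. fderiv f (p, z) (u, 0))) (at p)"
  by (rule has_derivative_compose[where f="\<lambda>p. (p, z)", OF _ C1_on_has_derivative[OF f]])
    (use p in \<open>auto intro!: derivative_eq_intros\<close>)

lemma fderiv_om:
  assumes p: "p \<in> cimg X i"
  shows "fderiv (\<lambda>q. om i (cinv X i q) v w) p u
    = fderiv (horiz i v w) (p, 1) (u, 0) - fderiv (horiz i v w) (p, - 1) (u, 0)"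
proof -
  have "fderiv (\<lambda>q. om i (cinv X i q) v w) p = fderiv (\<lambda>q. horiz i v w (q, 1) - horiz i v w (q, - 1)) p"
    by (rule fderiv_cong_open[OF open_cimg p]) (rule om_horiz)
  also have "\<dots> = (\<lambda>u. fderiv (horiz i v w) (p, 1) (u, 0) - fderiv (horiz i v w) (p, - 1) (u, 0))"
    by (rule fderiv_eq, intro has_derivative_diff fderiv_slice[OF C1_horiz p])
  finally show ?thesis by simp
qed

text \<open>The fundamental theorem of calculus integrates \<open>fderiv_horiz_vertical\<close> over
  the segment, and the derivatives along \<open>X\<close> are pulled out of the integral.\<close>

lemma om_exact:
  assumes p: "p \<in> cimg X i"
  shows "om i (cinv X i p) v w
    = fderiv (\<lambda>q. al i (cinv X i q) w) p v - fderiv (\<lambda>q. al i (cinv X i q) v) p w"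
proof -
  let ?d = "\<lambda>w v t. fderiv (vert i w) (p, of_real t) (v, 0)"
  have "((\<lambda>t. horiz i v w (p, of_real t)) has_vector_derivative (?d w v t - ?d v w t)) (at t within {-1..1})" for t
  proof -
    have lin: "linear (fderiv (horiz i v w) (p, of_real t))"
      by (rule C1_on_linear_fderiv[OF C1_horiz]) (use p in simp)
    have "((\<lambda>t. horiz i v w (p, of_real t)) has_derivative
        (\<lambda>s. fderiv (horiz i v w) (p, of_real t) (0, of_real s))) (at t within {-1..1})"
      by (rule has_derivative_at_withinI,
          rule has_derivative_compose[where f="\<lambda>t. (p, of_real t)", OF _ C1_on_has_derivative[OF C1_horiz]])
        (use p in \<open>auto intro!: derivative_eq_intros\<close>)
    moreover have "(0, of_real s) = s *\<^sub>R (0 :: 'e, 1 :: complex)" for s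
      by (simp add: scaleR_conv_of_real)
    ultimately show ?thesis
      unfolding has_vector_derivative_def
      by (simp only: linear_scale[OF lin] fderiv_horiz_vertical[OF p])
  qed
  then have "((\<lambda>t. ?d w v t - ?d v w t) has_integral horiz i v w (p, of_real 1) - horiz i v w (p, of_real (- 1))) {-1..1}"
    by (intro fundamental_theorem_of_calculus) auto
  then have "om i (cinv X i p) v w = integral {-1..1} (\<lambda>t. ?d w v t - ?d v w t)"
    by (simp add: om_horiz[OF p] integral_unique)
  also have "\<dots> = integral {-1..1} (?d w v) - integral {-1..1} (?d v w)"
  proof (rule integral_diff)
    show "(?d w v) integrable_on {-1..1}" for v w
      by (rule integrable_continuous_real, rule continuous_on_compose2[OF C1_on_fderiv_continuous[OF C1_vert]])
        (use p in \<open>auto intro!: continuous_intros\<close>)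
    then show "(?d v w) integrable_on {-1..1}" .
  qed
  finally show ?thesis
    by (simp add: al_vert C1_on_parameter_integral(2)[OF open_cimg C1_vert p])
qed

lemma linear_al:
  assumes x: "x \<in> cdom X i"
  shows "linear (al i x)"
proof -
  have lin: "linear (gz i x z v)" for z v
    using bilinear_gz[OF x] unfolding bilinear_def by blast
  have pair: "(a + b, 0) = (a, 0) + (b, 0 :: complex)" "(c *\<^sub>R a, 0) = c *\<^sub>R (a, 0 :: complex)" for a b :: 'e and c
    by simp_all
  have int: "(\<lambda>t. gz i x (of_real t) (0, \<i>) (w, 0)) integrable_on {-1..1}" for w
  proof -
    have "continuous_on {-1..1} (\<lambda>t. vert i w (coord X i x, of_real t))"
      by (rule continuous_on_compose2[OF C1_on_continuous[OF C1_vert]])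
        (use coord_in[OF x] in \<open>auto intro!: continuous_intros\<close>)
    then show ?thesis
      using x by (simp add: vert_def integrable_continuous_real)
  qed
  show ?thesis
  proof (rule linearI)
    show "al i x (v + w) = al i x v + al i x w" for v w
      unfolding al_def pair linear_add[OF lin] by (rule integral_add[OF int int])
    show "al i x (c *\<^sub>R v) = c *\<^sub>R al i x v" for c v
      unfolding al_def pair linear_scale[OF lin] by simp
  qed
qed

lemma exact_symplectic: "exact_symplectic_manifold X om al"
proof
  fix i x assume x: "x \<in> cdom X i"
  have lin: "linear (\<lambda>v. gz i x z v w)" "linear (gz i x z v)" for z v w
    using bilinear_gz[OF x] unfolding bilinear_def by blast+
  have pair: "(a + b, 0) = (a, 0) + (b, 0 :: complex)" "(c *\<^sub>R a, 0) = c *\<^sub>R (a, 0 :: complex)" for a b :: 'e and c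
    by simp_all
  show "bilinear (om i x)"
    unfolding bilinear_def om_def
    by (intro conjI allI linearI; simp only: pair linear_add[OF linear_J[OF x]] linear_scale[OF linear_J[OF x]]
        linear_add[OF lin(1)] linear_add[OF lin(2)] linear_scale[OF lin(1)] linear_scale[OF lin(2)])
      (simp_all add: algebra_simps)
next
  fix i x v w and c :: real assume x: "x \<in> cdom X i"
  show "al i x (v + w) = al i x v + al i x w"
    by (rule linear_add[OF linear_al[OF x]])
  show "al i x (c *\<^sub>R v) = c *\<^sub>R al i x v"
    by (rule linear_scale[OF linear_al[OF x]])
next
  fix i x v assume x: "x \<in> cdom X i" and null: "\<And>w. om i x v w = 0"
  show "v = 0"
  proof (rule ccontr)
    assume "v \<noteq> 0"
    then have "J i x v \<noteq> 0"
      using JJ[OF x, of v] linear_0[OF linear_J[OF x]] by auto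
    then have "(J i x v, 0) \<noteq> (0 :: 'e \<times> complex)"
      by (simp add: zero_prod_def)
    \<comment> \<open>The test vector \<open>J v\<close> turns both summands of \<open>om\<close>
      into squared lengths of \<open>J v\<close>.\<close>
    then have "om i x v (J i x v) > 0"
      unfolding om_def by (intro add_pos_pos gz_pos[OF x])
    then show False
      using null by simp
  qed
next
  fix i v w
  show "C1_on (cimg X i) (\<lambda>p. om i (cinv X i p) v w)"
    by (subst C1_on_cong[OF open_cimg om_horiz], assumption) (intro C1_on_diff C1_slice C1_horiz)
next
  fix i w
  show "C1_on (cimg X i) (\<lambda>p. al i (cinv X i p) w)"
    unfolding al_vert by (rule C1_on_parameter_integral(1)[OF open_cimg C1_vert])
next
  fix i j x v w assume x: "x \<in> cdom X i \<inter> cdom X j"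
  show "om j x (tangent_change X i j x v) (tangent_change X i j x w) = om i x v w"
    unfolding om_def complex_structure_change[OF complex_structures(2) x, symmetric] gz_change[OF x] ..
  show "al j x (tangent_change X i j x w) = al i x w"
    unfolding al_def using gz_change[OF x, of _ 0 \<i>] linear_0[OF linear_tangent_change[OF x]] by simp
next
  show "closed_2form X om"
    unfolding closed_2form_def
  proof (intro allI ballI)
    fix i p u v w assume p: "p \<in> cimg X i"
    show "fderiv (\<lambda>q. om i (cinv X i q) v w) p u + fderiv (\<lambda>q. om i (cinv X i q) w u) p v
      + fderiv (\<lambda>q. om i (cinv X i q) u v) p w = 0"
      using horiz_closed[OF p, of v w 1 u] horiz_closed[OF p, of v w "- 1" u]
      unfolding fderiv_om[OF p] by linarith
  qed
qed (rule om_exact)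

end

text \<open>Nonemptiness is where the contradiction lands, since the symplectic argument shows that
  \<open>X\<close> has no points. Over the empty manifold every \<open>g\<close> would satisfy
  \<open>kaehler_metric\<close> vacuously.\<close>

theorem theorem2p1:
  fixes X :: "('a, 'i, 'e::euclidean_space) manifold"
    and I J K :: "('a, 'i, 'e) endo_field"
  assumes "hypercomplex_manifold X I J K"
    and "compact_space (mtop X)"
    and "topspace (mtop X) \<noteq> {}"
  shows "\<not> (\<exists>g. kaehler_metric (twistor_space X) (twistor_structure I J K) g)"
proof
  assume "\<exists>g. kaehler_metric (twistor_space X) (twistor_structure I J K) g"
  then obtain g where g: "kaehler_metric (twistor_space X) (twistor_structure I J K) g"
    by blast
  have "smooth_manifold X"
    using assms(1) unfolding hypercomplex_manifold_def by blast
  then interpret kaehler_twistor_space X I J K g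
    using assms(1) g by unfold_locales
  interpret exact_symplectic_manifold X om al
    by (rule exact_symplectic)
  show False
    using compact_imp_empty[OF assms(2)] assms(3) by blast
qed

end
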